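(* There exist finite, perfect and centrally indecomposable groups $Q_1, Q_2$, and a central product $G = Q_1Q_2$, such that (1) $Q_1, Q_2$ are characteristic in $G$; (2) the group $(G, \circ)$ obtained from $G$ by replacing $Q_1$ with its opposite is not isomorphic to $G$. Moreover, $Q_1$ and $Q_2$ are still characteristic in $(G, \circ)$.
   Context: A group is perfect if it equals its derived subgroup. $G$ is a central product of subgroups $Q_1, Q_2$ if $G = Q_1Q_2$ and $[Q_1, Q_2] = 1$. A non-trivial perfect group is centrally indecomposable if it is not a central product of two proper subgroups. The opposite of a group is the group obtained by exchanging the order of factors in its product. If $G = Q_1Q_2$ is a central product, the group $(G, \circ)$ obtained from $G$ by replacing $Q_1$ with its opposite is the set $G$ with the (well-defined) group operation $$(xy) \circ (ab) = (ax)(yb), \qquad x, a \in Q_1,\ y, b \in Q_2;$$ the subsets $Q_1, Q_2$ are also subgroups of $(G,\circ)$. *)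

theory Defs
  imports "HOL-Algebra.Algebra"
begin

definition perfect_group :: "('a, 'b) monoid_scheme \<Rightarrow> bool" where
  "perfect_group G \<longleftrightarrow> group G \<and> derived G (carrier G) = carrier G"

definition commutator_subgroup ::
    "('a, 'b) monoid_scheme \<Rightarrow> 'a set \<Rightarrow> 'a set \<Rightarrow> 'a set" where
  "commutator_subgroup G H K =
     generate G (\<Union>h \<in> H. \<Union>k \<in> K. {h \<otimes>\<^bsub>G\<^esub> k \<otimes>\<^bsub>G\<^esub> inv\<^bsub>G\<^esub> h \<otimes>\<^bsub>G\<^esub> inv\<^bsub>G\<^esub> k})"

lemma commutator_subgroup_self: "commutator_subgroup G H H = derived G H"
  by (simp add: commutator_subgroup_def derived_def)

definition central_product ::
    "('a, 'b) monoid_scheme \<Rightarrow> 'a set \<Rightarrow> 'a set \<Rightarrow> bool" where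
  "central_product G Q1 Q2 \<longleftrightarrow>
     group G \<and> subgroup Q1 G \<and> subgroup Q2 G \<and>
     carrier G = Q1 <#>\<^bsub>G\<^esub> Q2 \<and> commutator_subgroup G Q1 Q2 = {\<one>\<^bsub>G\<^esub>}"

definition centrally_indecomposable :: "('a, 'b) monoid_scheme \<Rightarrow> bool" where
  "centrally_indecomposable G \<longleftrightarrow>
     perfect_group G \<and> \<not> trivial_group G \<and>
     \<not> (\<exists>H K. central_product G H K \<and> H \<noteq> carrier G \<and> K \<noteq> carrier G)"

definition characteristic_subgroup :: "'a set \<Rightarrow> ('a, 'b) monoid_scheme \<Rightarrow> bool" where
  "characteristic_subgroup H G \<longleftrightarrow> subgroup H G \<and> (\<forall>\<phi> \<in> iso G G. \<phi> ` H = H)"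

text \<open>
  The multiplication is a definite description, since an element of the group may factor in
  several ways; for a central product the description is proper (lemma \<open>replace_opposite_mult\<close>).
\<close>

definition replace_opposite ::
    "('a, 'b) monoid_scheme \<Rightarrow> 'a set \<Rightarrow> 'a set \<Rightarrow> 'a monoid" where
  "replace_opposite G Q1 Q2 =
     \<lparr>carrier = carrier G,
      monoid.mult = (\<lambda>g h. THE z. \<exists>x \<in> Q1. \<exists>y \<in> Q2. \<exists>a \<in> Q1. \<exists>b \<in> Q2.
                g = x \<otimes>\<^bsub>G\<^esub> y \<and> h = a \<otimes>\<^bsub>G\<^esub> b \<and>
                z = (a \<otimes>\<^bsub>G\<^esub> x) \<otimes>\<^bsub>G\<^esub> (y \<otimes>\<^bsub>G\<^esub> b)),
      monoid.one = \<one>\<^bsub>G\<^esub>\<rparr>"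

lemma central_product_commute:
  assumes "central_product G Q1 Q2" "x \<in> Q1" "y \<in> Q2"
  shows "x \<otimes>\<^bsub>G\<^esub> y = y \<otimes>\<^bsub>G\<^esub> x"
proof -
  interpret group G using assms(1) by (simp add: central_product_def)
  have c: "x \<in> carrier G" "y \<in> carrier G"
    using assms by (auto simp: central_product_def dest: subgroup.mem_carrier)
  have "x \<otimes>\<^bsub>G\<^esub> y \<otimes>\<^bsub>G\<^esub> inv\<^bsub>G\<^esub> x \<otimes>\<^bsub>G\<^esub> inv\<^bsub>G\<^esub> y \<in> commutator_subgroup G Q1 Q2"
    unfolding commutator_subgroup_def using assms(2,3) by (intro generate.incl) blast
  then have e: "x \<otimes>\<^bsub>G\<^esub> y \<otimes>\<^bsub>G\<^esub> inv\<^bsub>G\<^esub> x \<otimes>\<^bsub>G\<^esub> inv\<^bsub>G\<^esub> y = \<one>\<^bsub>G\<^esub>"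
    using assms(1) by (simp add: central_product_def)
  have "x \<otimes>\<^bsub>G\<^esub> y \<otimes>\<^bsub>G\<^esub> inv\<^bsub>G\<^esub> x \<otimes>\<^bsub>G\<^esub> inv\<^bsub>G\<^esub> y = (x \<otimes>\<^bsub>G\<^esub> y) \<otimes>\<^bsub>G\<^esub> inv\<^bsub>G\<^esub> (y \<otimes>\<^bsub>G\<^esub> x)"
    using c by (simp add: inv_mult_group m_assoc)
  with e have "(x \<otimes>\<^bsub>G\<^esub> y) \<otimes>\<^bsub>G\<^esub> inv\<^bsub>G\<^esub> (y \<otimes>\<^bsub>G\<^esub> x) = \<one>\<^bsub>G\<^esub>" by simp
  then have "x \<otimes>\<^bsub>G\<^esub> y = \<one>\<^bsub>G\<^esub> \<otimes>\<^bsub>G\<^esub> (y \<otimes>\<^bsub>G\<^esub> x)"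
    using c by (metis inv_solve_right m_closed one_closed)
  then show ?thesis using c by simp
qed

lemma central_product_welldef:
  assumes cp: "central_product G Q1 Q2"
    and Q1: "x \<in> Q1" "a \<in> Q1" "x' \<in> Q1" "a' \<in> Q1"
    and Q2: "y \<in> Q2" "b \<in> Q2" "y' \<in> Q2" "b' \<in> Q2"
    and g: "x \<otimes>\<^bsub>G\<^esub> y = x' \<otimes>\<^bsub>G\<^esub> y'" and h: "a \<otimes>\<^bsub>G\<^esub> b = a' \<otimes>\<^bsub>G\<^esub> b'"
  shows "(a \<otimes>\<^bsub>G\<^esub> x) \<otimes>\<^bsub>G\<^esub> (y \<otimes>\<^bsub>G\<^esub> b) = (a' \<otimes>\<^bsub>G\<^esub> x') \<otimes>\<^bsub>G\<^esub> (y' \<otimes>\<^bsub>G\<^esub> b')"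
proof -
  interpret group G using cp by (simp add: central_product_def)
  have s: "subgroup Q1 G" "subgroup Q2 G" using cp by (auto simp: central_product_def)
  note c = subgroup.mem_carrier[OF s(1)] subgroup.mem_carrier[OF s(2)]
  note cc = Q1[THEN c(1)] Q2[THEN c(2)]
  define w where "w = inv\<^bsub>G\<^esub> a' \<otimes>\<^bsub>G\<^esub> a"
  have wc: "w \<in> carrier G" using cc by (simp add: w_def)
  have aw: "a = a' \<otimes>\<^bsub>G\<^esub> w" using cc by (simp add: w_def m_assoc[symmetric])
  have "a' \<otimes>\<^bsub>G\<^esub> (w \<otimes>\<^bsub>G\<^esub> b) = a' \<otimes>\<^bsub>G\<^esub> b'"
    using h cc wc by (simp add: aw m_assoc)
  then have wb: "w \<otimes>\<^bsub>G\<^esub> b = b'" using cc wc by simp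
  have w1: "w \<in> Q1"
    using s(1) Q1 by (simp add: w_def subgroup.m_closed subgroup.m_inv_closed)
  have "w = b' \<otimes>\<^bsub>G\<^esub> inv\<^bsub>G\<^esub> b" using wb cc wc by (metis inv_solve_right)
  then have w2: "w \<in> Q2"
    using s(2) Q2 by (simp add: subgroup.m_closed subgroup.m_inv_closed)
  have "w \<otimes>\<^bsub>G\<^esub> (x \<otimes>\<^bsub>G\<^esub> y) = (x \<otimes>\<^bsub>G\<^esub> y) \<otimes>\<^bsub>G\<^esub> w"
    using central_product_commute[OF cp Q1(1) w2] central_product_commute[OF cp w1 Q2(1)] cc wc
    by (metis m_assoc)
  then have "a' \<otimes>\<^bsub>G\<^esub> w \<otimes>\<^bsub>G\<^esub> (x \<otimes>\<^bsub>G\<^esub> y) \<otimes>\<^bsub>G\<^esub> b = a' \<otimes>\<^bsub>G\<^esub> (x \<otimes>\<^bsub>G\<^esub> y) \<otimes>\<^bsub>G\<^esub> (w \<otimes>\<^bsub>G\<^esub> b)"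
    using cc wc by (simp add: m_assoc)
  then have "a \<otimes>\<^bsub>G\<^esub> (x \<otimes>\<^bsub>G\<^esub> y) \<otimes>\<^bsub>G\<^esub> b = a' \<otimes>\<^bsub>G\<^esub> (x' \<otimes>\<^bsub>G\<^esub> y') \<otimes>\<^bsub>G\<^esub> b'"
    using aw wb g by simp
  then show ?thesis using cc by (simp add: m_assoc)
qed

lemma replace_opposite_simps [simp]:
  "carrier (replace_opposite G Q1 Q2) = carrier G"
  "\<one>\<^bsub>replace_opposite G Q1 Q2\<^esub> = \<one>\<^bsub>G\<^esub>"
  by (simp_all add: replace_opposite_def)

lemma replace_opposite_mult:
  assumes "central_product G Q1 Q2" "x \<in> Q1" "y \<in> Q2" "a \<in> Q1" "b \<in> Q2"
  shows "(x \<otimes>\<^bsub>G\<^esub> y) \<otimes>\<^bsub>replace_opposite G Q1 Q2\<^esub> (a \<otimes>\<^bsub>G\<^esub> b) =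
         (a \<otimes>\<^bsub>G\<^esub> x) \<otimes>\<^bsub>G\<^esub> (y \<otimes>\<^bsub>G\<^esub> b)"
proof -
  let ?P = "\<lambda>z. \<exists>x' \<in> Q1. \<exists>y' \<in> Q2. \<exists>a' \<in> Q1. \<exists>b' \<in> Q2.
              x \<otimes>\<^bsub>G\<^esub> y = x' \<otimes>\<^bsub>G\<^esub> y' \<and> a \<otimes>\<^bsub>G\<^esub> b = a' \<otimes>\<^bsub>G\<^esub> b' \<and>
              z = (a' \<otimes>\<^bsub>G\<^esub> x') \<otimes>\<^bsub>G\<^esub> (y' \<otimes>\<^bsub>G\<^esub> b')"
  have "(THE z. ?P z) = (a \<otimes>\<^bsub>G\<^esub> x) \<otimes>\<^bsub>G\<^esub> (y \<otimes>\<^bsub>G\<^esub> b)"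
  proof (rule the_equality)
    show "?P ((a \<otimes>\<^bsub>G\<^esub> x) \<otimes>\<^bsub>G\<^esub> (y \<otimes>\<^bsub>G\<^esub> b))" using assms by blast
  next
    fix z assume "?P z"
    then obtain x' y' a' b' where *: "x' \<in> Q1" "y' \<in> Q2" "a' \<in> Q1" "b' \<in> Q2"
      "x \<otimes>\<^bsub>G\<^esub> y = x' \<otimes>\<^bsub>G\<^esub> y'" "a \<otimes>\<^bsub>G\<^esub> b = a' \<otimes>\<^bsub>G\<^esub> b'"
      "z = (a' \<otimes>\<^bsub>G\<^esub> x') \<otimes>\<^bsub>G\<^esub> (y' \<otimes>\<^bsub>G\<^esub> b')" by blast
    show "z = (a \<otimes>\<^bsub>G\<^esub> x) \<otimes>\<^bsub>G\<^esub> (y \<otimes>\<^bsub>G\<^esub> b)"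
      unfolding *(7)
      by (rule central_product_welldef[OF assms(1) *(1,3) assms(2,4) *(2,4) assms(3,5)
            *(5)[symmetric] *(6)[symmetric]])
  qed
  then show ?thesis by (simp add: replace_opposite_def)
qed

lemma replace_opposite_mult':
  assumes "central_product G Q1 Q2" "g \<in> carrier G" "a \<in> Q1" "b \<in> Q2"
  shows "g \<otimes>\<^bsub>replace_opposite G Q1 Q2\<^esub> (a \<otimes>\<^bsub>G\<^esub> b) = a \<otimes>\<^bsub>G\<^esub> g \<otimes>\<^bsub>G\<^esub> b"
proof -
  interpret group G using assms by (simp add: central_product_def)
  have s: "subgroup Q1 G" "subgroup Q2 G" using assms by (auto simp: central_product_def)
  obtain x y where xy: "x \<in> Q1" "y \<in> Q2" "g = x \<otimes>\<^bsub>G\<^esub> y"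
    using assms by (auto simp: central_product_def set_mult_def)
  then show ?thesis
    using replace_opposite_mult[OF assms(1) xy(1,2) assms(3,4)] assms s
    by (simp add: m_assoc subgroup.mem_carrier[OF s(1)] subgroup.mem_carrier[OF s(2)])
qed

lemma group_replace_opposite:
  assumes cp: "central_product G Q1 Q2"
  shows "group (replace_opposite G Q1 Q2)"
proof -
  interpret group G using cp by (simp add: central_product_def)
  have s: "subgroup Q1 G" "subgroup Q2 G" using cp by (auto simp: central_product_def)
  note c = subgroup.mem_carrier[OF s(1)] subgroup.mem_carrier[OF s(2)]
  note cl = subgroup.m_closed[OF s(1)] subgroup.m_closed[OF s(2)]
  have dec: "\<exists>a \<in> Q1. \<exists>b \<in> Q2. g = a \<otimes>\<^bsub>G\<^esub> b" if "g \<in> carrier G" for g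
    using that cp by (auto simp: central_product_def set_mult_def)
  note m = replace_opposite_mult'[OF cp]
  show ?thesis
  proof (rule groupI; simp)
    fix g h assume g: "g \<in> carrier G" and h: "h \<in> carrier G"
    obtain a b where "a \<in> Q1" "b \<in> Q2" "h = a \<otimes>\<^bsub>G\<^esub> b" using dec[OF h] by blast
    then show "g \<otimes>\<^bsub>replace_opposite G Q1 Q2\<^esub> h \<in> carrier G"
      using g by (simp add: m c)
  next
    fix g h k assume g: "g \<in> carrier G" and h: "h \<in> carrier G" and k: "k \<in> carrier G"
    obtain a b where ab: "a \<in> Q1" "b \<in> Q2" "h = a \<otimes>\<^bsub>G\<^esub> b" using dec[OF h] by blast
    obtain d e where de: "d \<in> Q1" "e \<in> Q2" "k = d \<otimes>\<^bsub>G\<^esub> e" using dec[OF k] by blast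
    have "h \<otimes>\<^bsub>replace_opposite G Q1 Q2\<^esub> k = (d \<otimes>\<^bsub>G\<^esub> a) \<otimes>\<^bsub>G\<^esub> (b \<otimes>\<^bsub>G\<^esub> e)"
      using ab de h m[OF h de(1,2)] by (simp add: c m_assoc)
    then have "g \<otimes>\<^bsub>replace_opposite G Q1 Q2\<^esub> (h \<otimes>\<^bsub>replace_opposite G Q1 Q2\<^esub> k) = (d \<otimes>\<^bsub>G\<^esub> a) \<otimes>\<^bsub>G\<^esub> g \<otimes>\<^bsub>G\<^esub> (b \<otimes>\<^bsub>G\<^esub> e)"
      using m[OF g cl(1)[OF de(1) ab(1)] cl(2)[OF ab(2) de(2)]] by simp
    moreover have "g \<otimes>\<^bsub>replace_opposite G Q1 Q2\<^esub> h \<otimes>\<^bsub>replace_opposite G Q1 Q2\<^esub> k = d \<otimes>\<^bsub>G\<^esub> (a \<otimes>\<^bsub>G\<^esub> g \<otimes>\<^bsub>G\<^esub> b) \<otimes>\<^bsub>G\<^esub> e"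
      using ab de g by (simp add: m c)
    ultimately show "g \<otimes>\<^bsub>replace_opposite G Q1 Q2\<^esub> h \<otimes>\<^bsub>replace_opposite G Q1 Q2\<^esub> k =
        g \<otimes>\<^bsub>replace_opposite G Q1 Q2\<^esub> (h \<otimes>\<^bsub>replace_opposite G Q1 Q2\<^esub> k)"
      using ab de g by (simp add: c m_assoc)
  next
    fix g assume g: "g \<in> carrier G"
    obtain a b where ab: "a \<in> Q1" "b \<in> Q2" "g = a \<otimes>\<^bsub>G\<^esub> b" using dec[OF g] by blast
    then show "\<one>\<^bsub>G\<^esub> \<otimes>\<^bsub>replace_opposite G Q1 Q2\<^esub> g = g" by (simp add: m c)
    have "inv\<^bsub>G\<^esub> a \<otimes>\<^bsub>G\<^esub> inv\<^bsub>G\<^esub> b \<otimes>\<^bsub>replace_opposite G Q1 Q2\<^esub> g = \<one>\<^bsub>G\<^esub>"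
      using ab by (simp add: m c m_assoc[symmetric])
    then show "\<exists>h \<in> carrier G. h \<otimes>\<^bsub>replace_opposite G Q1 Q2\<^esub> g = \<one>\<^bsub>G\<^esub>"
      using ab by (intro bexI[of _ "inv\<^bsub>G\<^esub> a \<otimes>\<^bsub>G\<^esub> inv\<^bsub>G\<^esub> b"]) (auto simp: c)
  qed
qed

end

theory Submission
  imports Defs "HOL-Library.Numeral_Type" "HOL-Library.Cardinality"
begin

text \<open>
  If every automorphism of \<open>Q\<^sub>1\<close> and of \<open>Q\<^sub>2\<close> fixes the amalgamated central element \<open>z\<close> of order 3, then
  \<open>(G, \<circ>)\<close> cannot be isomorphic to \<open>G\<close>: central factors that are perfect and centrally
  indecomposable are unique up to order, so an isomorphism preserves \<open>Q\<^sub>1\<close> and \<open>Q\<^sub>2\<close> as soon as their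
  orders differ; it is an automorphism of \<open>Q\<^sub>2\<close>, hence fixes \<open>z\<close>, and an anti-automorphism of
  \<open>Q\<^sub>1\<close>, hence inverts \<open>z\<close>.

  Such groups are \<open>F\<^sup>n \<rtimes> (D \<rtimes> A\<^sub>n)\<close> with \<open>F\<close> the field of 19 elements, \<open>9 dvd n\<close>, and \<open>D\<close> the diagonal
  matrices of determinant 1 with entries in the ninth roots of unity, acting on \<open>F\<^sup>n\<close> through their cubes.
  The scalar 4 has order 9 and acts on \<open>F\<^sup>n\<close> as the scalar \<open>4^3 = 7\<close>, and every group element \<open>g\<close> that acts
  as 7 satisfies \<open>g^3 = 7\<close>, since it differs from the scalar 4 by a translation and a diagonal
  matrix of exponent 3, and the translation drops out of \<open>g^3\<close> because \<open>1 + 7 + 7^2 = 0\<close> in \<open>F\<close>. As \<open>F\<^sup>n\<close> is characteristic, every automorphism fixes the central scalar 7.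
\<close>

section \<open>Central products\<close>

text \<open>Presenting the commutator by the equation
  \<open>g \<otimes> h = k \<otimes> (h \<otimes> g)\<close> keeps inverses out of concrete
  computations: in the group built below only products have to be compared. The next two lemmas do
  the same for normal subgroups.\<close>

lemma (in group) commutator_in_derived:
  assumes "g \<in> carrier G" "h \<in> carrier G" "k \<in> carrier G" "g \<otimes> h = k \<otimes> (h \<otimes> g)"
  shows "k \<in> derived G (carrier G)"
proof -
  have "k = g \<otimes> h \<otimes> inv (h \<otimes> g)" using assms by (simp add: inv_solve_right)
  then have "k = g \<otimes> h \<otimes> inv g \<otimes> inv h" using assms by (simp add: inv_mult_group m_assoc)
  then show ?thesis using assms(1,2) unfolding derived_def by (intro generate.incl) blast
qed

lemma (in group) commutator_in_normal:
  assumes M: "M \<lhd> G" and "g \<in> carrier G" "m \<in> M" "k \<in> carrier G" "g \<otimes> m = k \<otimes> (m \<otimes> g)"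
  shows "k \<in> M"
proof -
  interpret M: normal M G by fact
  have m: "m \<in> carrier G" using assms(3) by simp
  have "k = g \<otimes> m \<otimes> inv (m \<otimes> g)" using assms m by (simp add: inv_solve_right)
  also have "\<dots> = (g \<otimes> m \<otimes> inv g) \<otimes> inv m" using assms(2) m by (simp add: inv_mult_group m_assoc)
  also have "\<dots> \<in> M" using assms(2,3) by (simp add: M.inv_op_closed2)
  finally show ?thesis .
qed

lemma (in group) conjugate_in_normal:
  assumes M: "M \<lhd> G" and "g \<in> carrier G" "m \<in> M" "k \<in> carrier G" "g \<otimes> m = k \<otimes> g"
  shows "k \<in> M"
proof -
  interpret M: normal M G by fact
  have "k = g \<otimes> m \<otimes> inv g" using assms by (simp add: inv_solve_right)
  also have "\<dots> \<in> M" using assms(2,3) by (simp add: M.inv_op_closed2)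
  finally show ?thesis .
qed

lemma central_product_iff:
  fixes G (structure)
  shows "central_product G H K \<longleftrightarrow> group G \<and> subgroup H G \<and> subgroup K G \<and>
     carrier G \<subseteq> H <#> K \<and> (\<forall>h \<in> H. \<forall>k \<in> K. h \<otimes> k = k \<otimes> h)"
    (is "_ \<longleftrightarrow> ?rhs")
proof
  assume cp: "central_product G H K"
  moreover have "\<forall>h \<in> H. \<forall>k \<in> K. h \<otimes> k = k \<otimes> h" using central_product_commute[OF cp] by blast
  ultimately show ?rhs by (simp add: central_product_def)
next
  assume ?rhs
  then have s: "subgroup H G" "subgroup K G" and c: "carrier G \<subseteq> H <#> K"
    and comm: "\<And>h k. h \<in> H \<Longrightarrow> k \<in> K \<Longrightarrow> h \<otimes> k = k \<otimes> h" by auto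
  interpret group G using \<open>?rhs\<close> by simp
  note mem = subgroup.mem_carrier[OF s(1)] subgroup.mem_carrier[OF s(2)]
  have "h \<otimes> k \<otimes> inv h \<otimes> inv k = \<one>" if "h \<in> H" "k \<in> K" for h k
  proof -
    have "h \<otimes> k \<otimes> inv h \<otimes> inv k = (h \<otimes> k) \<otimes> inv (k \<otimes> h)"
      using that by (simp add: inv_mult_group m_assoc mem)
    moreover have "k \<otimes> h \<otimes> inv (k \<otimes> h) = \<one>" using that by (intro r_inv) (simp add: mem)
    ultimately show ?thesis using comm[OF that] by simp
  qed
  then have "(\<Union>h \<in> H. \<Union>k \<in> K. {h \<otimes> k \<otimes> inv h \<otimes> inv k}) = {\<one>}"
    using s[THEN subgroup.one_closed] by auto
  then have "commutator_subgroup G H K = {\<one>}"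
    by (simp add: commutator_subgroup_def generate_one)
  moreover have "H <#> K \<subseteq> carrier G" by (auto simp: set_mult_def mem)
  ultimately show "central_product G H K" using s c by (simp add: central_product_def group_axioms)
qed

lemma central_product_sym:
  assumes "central_product G H K" shows "central_product G K H"
  using assms unfolding central_product_iff by (fastforce simp: set_mult_def)

text \<open>The other factor centralizes \<open>H\<close>, so \<open>h \<otimes> k\<close>
  conjugates elements of \<open>H\<close> just as \<open>h\<close> does.\<close>

lemma central_product_normal:
  fixes G (structure)
  assumes cp: "central_product G H K" shows "H \<lhd> G"
proof -
  interpret group G using cp by (simp add: central_product_def)
  have s: "subgroup H G" "subgroup K G" using cp by (auto simp: central_product_def)
  note mem = subgroup.mem_carrier[OF s(1)] subgroup.mem_carrier[OF s(2)]
  show ?thesis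
  proof (rule normal_invI[OF s(1)])
    fix g x assume g: "g \<in> carrier G" and x: "x \<in> H"
    obtain h k where hk: "h \<in> H" "k \<in> K" "g = h \<otimes> k"
      using g cp by (auto simp: central_product_def set_mult_def)
    have "k \<otimes> x \<otimes> inv k = x"
      using central_product_commute[OF cp x hk(2)] x hk by (simp add: mem inv_solve_right')
    then have "g \<otimes> x \<otimes> inv g = h \<otimes> x \<otimes> inv h"
      using x hk by (simp add: mem inv_mult_group m_assoc) (simp add: mem m_assoc[symmetric])
    then show "g \<otimes> x \<otimes> inv g \<in> H"
      using x hk(1) s(1) by (simp add: subgroup.m_closed subgroup.m_inv_closed)
  qed
qed

text \<open>When \<open>K\<close> is abelian, the commutator of \<open>a \<otimes> k\<close> and
  \<open>b \<otimes> l\<close> is that of \<open>a\<close> and \<open>b\<close>. Hence all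
  commutators lie in \<open>H\<close>, and perfectness does the rest.\<close>

lemma central_product_comm_factor:
  fixes G (structure)
  assumes cp: "central_product G H K" and pf: "perfect_group G"
    and comm: "\<And>k l. k \<in> K \<Longrightarrow> l \<in> K \<Longrightarrow> k \<otimes> l = l \<otimes> k"
  shows "H = carrier G"
proof -
  interpret group G using cp by (simp add: central_product_def)
  have s: "subgroup H G" "subgroup K G" using cp by (auto simp: central_product_def)
  interpret H: subgroup H G by (rule s)
  note mem = subgroup.mem_carrier[OF s(1)] subgroup.mem_carrier[OF s(2)]
  note swap = central_product_commute[OF cp]
  have "f \<otimes> g \<otimes> inv f \<otimes> inv g \<in> H" if fg: "f \<in> carrier G" "g \<in> carrier G" for f g
  proof -
    obtain a k where a: "a \<in> H" "k \<in> K" "f = a \<otimes> k"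
      using fg cp by (auto simp: central_product_def set_mult_def)
    obtain b l where b: "b \<in> H" "l \<in> K" "g = b \<otimes> l"
      using fg cp by (auto simp: central_product_def set_mult_def)
    let ?c = "a \<otimes> b \<otimes> inv (b \<otimes> a)"
    have fg': "f \<otimes> g = (a \<otimes> b) \<otimes> (k \<otimes> l)" "g \<otimes> f = (b \<otimes> a) \<otimes> (k \<otimes> l)"
      using a b swap[of b k] swap[of a l] comm[of k l] by (metis m_assoc m_closed mem)+
    have "p \<otimes> r = p \<otimes> inv q \<otimes> (q \<otimes> r)" if "p \<in> carrier G" "q \<in> carrier G" "r \<in> carrier G" for p q r
      using that by (simp add: m_assoc m_assoc[symmetric, of "inv q" q r])
    then have "f \<otimes> g = ?c \<otimes> (g \<otimes> f)"
      unfolding fg' using a b by (simp add: mem)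
    then have "f \<otimes> g \<otimes> inv (g \<otimes> f) = ?c" using a b fg by (simp add: mem inv_solve_right')
    then have "f \<otimes> g \<otimes> inv f \<otimes> inv g = ?c" using fg by (simp add: inv_mult_group m_assoc)
    then show ?thesis using a b by simp
  qed
  then have "derived G (carrier G) \<subseteq> H"
    unfolding derived_def by (intro generate_subgroup_incl[OF _ s(1)]) blast
  then show ?thesis using pf H.subset by (auto simp: perfect_group_def)
qed

section \<open>Transport of perfectness and central products along isomorphisms\<close>

lemma iso_perfect_group:
  assumes f: "f \<in> iso A B" and A: "perfect_group A" and B: "group B"
  shows "perfect_group B"
proof -
  interpret group_hom A B f
    using assms by (simp add: group_hom_def group_hom_axioms_def iso_def perfect_group_def)
  have "f ` carrier A = carrier B" using f by (simp add: iso_def bij_betw_def)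
  then show ?thesis using derived_img[of "carrier A"] A B by (simp add: perfect_group_def)
qed

lemma iso_central_product:
  assumes f: "f \<in> iso A B" and A: "central_product A H K" and B: "group B"
  shows "central_product B (f ` H) (f ` K)"
proof -
  interpret group_hom A B f
    using assms by (simp add: group_hom_def group_hom_axioms_def iso_def central_product_def)
  have fc: "f ` carrier A = carrier B" using f by (simp add: iso_def bij_betw_def)
  have s: "subgroup H A" "subgroup K A" using A by (auto simp: central_product_def)
  note mem = subgroup.mem_carrier[OF s(1)] subgroup.mem_carrier[OF s(2)]
  have "carrier B \<subseteq> f ` H <#>\<^bsub>B\<^esub> f ` K"
  proof
    fix z assume "z \<in> carrier B"
    then obtain a where "a \<in> carrier A" "z = f a" using fc by blast
    then obtain h k where "h \<in> H" "k \<in> K" "z = f (h \<otimes>\<^bsub>A\<^esub> k)"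
      using A by (auto simp: central_product_def set_mult_def)
    then have "z = f h \<otimes>\<^bsub>B\<^esub> f k" by (simp add: mem)
    then show "z \<in> f ` H <#>\<^bsub>B\<^esub> f ` K" using \<open>h \<in> H\<close> \<open>k \<in> K\<close> by (auto simp: set_mult_def)
  qed
  moreover have "f h \<otimes>\<^bsub>B\<^esub> f k = f k \<otimes>\<^bsub>B\<^esub> f h" if "h \<in> H" "k \<in> K" for h k
    using arg_cong[OF central_product_commute[OF A that], of f] that by (simp add: mem)
  ultimately show ?thesis
    using s by (auto simp: central_product_iff B subgroup_img_is_subgroup)
qed

text \<open>A decomposition of \<open>B\<close> into proper factors would pull back along the
  inverse isomorphism \<open>g\<close> to one of \<open>A\<close>.\<close>

lemma iso_centrally_indecomposable:
  assumes f: "f \<in> iso A B" and A: "centrally_indecomposable A" and B: "group B"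
  shows "centrally_indecomposable B"
proof -
  have gA: "group A" and pA: "perfect_group A" using A by (auto simp: centrally_indecomposable_def perfect_group_def)
  interpret group_hom A B f
    using f gA B by (simp add: group_hom_def group_hom_axioms_def iso_def)
  have bij: "bij_betw f (carrier A) (carrier B)" using f by (simp add: iso_def)
  define g where "g = inv_into (carrier A) f"
  have g: "g \<in> iso B A" unfolding g_def by (rule G.iso_set_sym[OF f])
  have "\<not> trivial_group B"
  proof
    assume "trivial_group B"
    then have "carrier B = {\<one>\<^bsub>B\<^esub>}" by (simp add: trivial_group_def)
    then have "card (carrier A) = 1" using bij_betw_same_card[OF bij] by simp
    then obtain a where "carrier A = {a}" by (auto simp: card_1_singleton_iff)
    then have "trivial_group A" using G.one_closed gA by (auto simp: trivial_group_def)
    then show False using A by (simp add: centrally_indecomposable_def)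
  qed
  moreover have "H = carrier B \<or> K = carrier B" if cp: "central_product B H K" for H K
  proof -
    have full: "L = carrier B" if "g ` L = carrier A" "L \<subseteq> carrier B" for L
    proof -
      have "f ` g ` L = L" using that(2) bij
        by (force simp: g_def image_image bij_betw_def f_inv_into_f)
      then show ?thesis using that(1) bij by (simp add: bij_betw_def)
    qed
    have "g ` H = carrier A \<or> g ` K = carrier A"
      using iso_central_product[OF g cp gA] A by (auto simp: centrally_indecomposable_def)
    then show ?thesis
      using full cp by (auto simp: central_product_def dest: subgroup.subset)
  qed
  ultimately show ?thesis
    using iso_perfect_group[OF f pA B] by (auto simp: centrally_indecomposable_def)
qed

section \<open>Uniqueness of centrally indecomposable factors\<close>

text \<open>Let \<open>q\<close> and \<open>r = p \<otimes> p'\<close> lie in \<open>Q1\<close>,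
  with \<open>p\<close> in \<open>P1\<close> and \<open>p'\<close> in \<open>P2\<close>. The
  commutator of \<open>q\<close> and \<open>r\<close> splits into those of \<open>q\<close> with
  \<open>p\<close> and with \<open>p'\<close>, which lie in \<open>Q1 \<inter> P1\<close> and
  \<open>Q1 \<inter> P2\<close> by normality. As \<open>Q1\<close> is perfect, it is the central
  product of these intersections, and indecomposability makes one of them all of
  \<open>Q1\<close>.\<close>

lemma central_factor_subset:
  fixes G (structure)
  assumes Q: "central_product G Q1 Q2" and P: "central_product G P1 P2"
    and ind: "centrally_indecomposable (G\<lparr>carrier := Q1\<rparr>)"
  shows "Q1 \<subseteq> P1 \<or> Q1 \<subseteq> P2"
proof -
  interpret group G using Q by (simp add: central_product_def)
  have s: "subgroup Q1 G" "subgroup P1 G" "subgroup P2 G"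
    using Q P by (auto simp: central_product_def)
  note mem = s[THEN subgroup.mem_carrier]
  have nQ: "Q1 \<lhd> G" and nP: "P1 \<lhd> G" "P2 \<lhd> G"
    using central_product_normal Q P central_product_sym by blast+
  have both: "\<exists>a \<in> M \<inter> N. g \<otimes> h = a \<otimes> (h \<otimes> g)"
    if M: "M \<lhd> G" and N: "N \<lhd> G" and g: "g \<in> M" and h: "h \<in> N" for M N g h
  proof -
    interpret M: normal M G by (rule M)
    interpret N: normal N G by (rule N)
    let ?a = "g \<otimes> h \<otimes> inv g \<otimes> inv h"
    have eq: "g \<otimes> h = ?a \<otimes> (h \<otimes> g)" using g h by (simp add: m_assoc m_assoc[symmetric, of "inv h" h g])
    have "?a = g \<otimes> (h \<otimes> inv g \<otimes> inv h)" using g h by (simp add: m_assoc)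
    also have "\<dots> \<in> M" using g h by (simp add: M.inv_op_closed2)
    finally have "?a \<in> M" .
    moreover have "?a \<in> N" using g h by (simp add: N.inv_op_closed2)
    ultimately show ?thesis using eq by blast
  qed
  let ?A = "Q1 \<inter> P1" and ?B = "Q1 \<inter> P2"
  have S: "subgroup (?A <#> ?B) G"
    using normal_subgroup_intersect[OF nQ nP(1)] subgroups_Inter_pair[OF s(1,3)]
    by (rule mult_norm_subgroup)
  have "q \<otimes> r \<otimes> inv q \<otimes> inv r \<in> ?A <#> ?B" if q: "q \<in> Q1" and r: "r \<in> Q1" for q r
  proof -
    obtain p p' where p: "p \<in> P1" "p' \<in> P2" "r = p \<otimes> p'"
      using mem(1)[OF r] P by (auto simp: central_product_def set_mult_def)
    obtain a where a: "a \<in> ?A" "q \<otimes> p = a \<otimes> (p \<otimes> q)" using both[OF nQ nP(1) q p(1)] by blast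
    obtain b where b: "b \<in> ?B" "q \<otimes> p' = b \<otimes> (p' \<otimes> q)" using both[OF nQ nP(2) q p(2)] by blast
    have c: "a \<in> carrier G" "b \<in> carrier G" "p \<in> carrier G" "p' \<in> carrier G" "q \<in> carrier G"
      using a b p q mem by auto
    have pb: "p \<otimes> b = b \<otimes> p" using central_product_commute[OF P p(1)] b(1) by blast
    have "q \<otimes> r = (q \<otimes> p) \<otimes> p'" using c by (simp add: p m_assoc)
    also have "\<dots> = a \<otimes> (p \<otimes> (q \<otimes> p'))" using c by (simp add: a(2) m_assoc)
    also have "\<dots> = a \<otimes> ((p \<otimes> b) \<otimes> (p' \<otimes> q))" using c by (simp add: b(2) m_assoc)
    also have "\<dots> = (a \<otimes> b) \<otimes> (r \<otimes> q)" using c by (simp add: pb p m_assoc)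
    finally have "q \<otimes> r \<otimes> inv (r \<otimes> q) = a \<otimes> b" using c p by (simp add: inv_solve_right')
    then have "q \<otimes> r \<otimes> inv q \<otimes> inv r = a \<otimes> b" using c p by (simp add: inv_mult_group m_assoc)
    then show ?thesis using a b by (auto simp: set_mult_def)
  qed
  then have "derived G Q1 \<subseteq> ?A <#> ?B"
    unfolding derived_def by (intro generate_subgroup_incl[OF _ S]) blast
  moreover have "derived G Q1 = Q1"
    using ind derived_consistent[OF _ s(1), of Q1] by (simp add: centrally_indecomposable_def perfect_group_def)
  ultimately have "central_product (G\<lparr>carrier := Q1\<rparr>) ?A ?B"
    using central_product_commute[OF P] subgroup_imp_group[OF s(1)]
      subgroup_incl[OF subgroups_Inter_pair[OF s(1,2)] s(1)] subgroup_incl[OF subgroups_Inter_pair[OF s(1,3)] s(1)]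
    by (auto simp: central_product_iff set_mult_def)
  then show ?thesis using ind by (auto simp: centrally_indecomposable_def)
qed

text \<open>Otherwise \<open>Q1\<close> would commute with itself, but a perfect abelian group is
  trivial.\<close>

lemma central_factor_not_subset:
  assumes Q: "central_product G Q1 Q2" and ind: "centrally_indecomposable (G\<lparr>carrier := Q1\<rparr>)"
  shows "\<not> Q1 \<subseteq> Q2"
proof
  assume sub: "Q1 \<subseteq> Q2"
  let ?B = "G\<lparr>carrier := Q1\<rparr>"
  have B: "perfect_group ?B" "\<not> trivial_group ?B" using ind by (auto simp: centrally_indecomposable_def)
  interpret B: group ?B using B by (simp add: perfect_group_def)
  have comm: "k \<otimes>\<^bsub>?B\<^esub> l = l \<otimes>\<^bsub>?B\<^esub> k" if "k \<in> Q1" "l \<in> Q1" for k l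
    using central_product_commute[OF Q that(1)] that sub by auto
  have "subgroup Q1 ?B" "subgroup {\<one>\<^bsub>G\<^esub>} ?B" using B.subgroup_self B.triv_subgroup by simp_all
  then have "central_product ?B {\<one>\<^bsub>G\<^esub>} Q1"
    using B.l_one B.r_one by (auto simp: central_product_iff B.group_axioms set_mult_def)
  from central_product_comm_factor[OF this B(1) comm] have "trivial_group ?B"
    by (simp add: trivial_group_def B.group_axioms)
  with B show False by simp
qed

lemma central_factors_unique:
  assumes Q: "central_product G Q1 Q2" and P: "central_product G P1 P2"
    and Qi: "centrally_indecomposable (G\<lparr>carrier := Q1\<rparr>)" "centrally_indecomposable (G\<lparr>carrier := Q2\<rparr>)"
    and Pi: "centrally_indecomposable (G\<lparr>carrier := P1\<rparr>)" "centrally_indecomposable (G\<lparr>carrier := P2\<rparr>)"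
    and fin: "finite P1" "finite P2"
    and card: "card P1 = card Q1" "card P2 = card Q2" "card Q1 \<noteq> card Q2"
  shows "P1 = Q1" "P2 = Q2"
proof -
  note Q' = central_product_sym[OF Q] and P' = central_product_sym[OF P]
  \<comment> \<open>The different orders exclude a swap: \<open>P2 \<subseteq> Q1\<close> would give
    \<open>P2 = Q1\<close>, hence equal orders, and \<open>P2 \<subseteq> Q2\<close> would put
    \<open>Q1\<close> inside \<open>Q2\<close>.\<close>
  have "\<not> Q1 \<subseteq> P2"
  proof
    assume "Q1 \<subseteq> P2"
    moreover have "P2 \<subseteq> Q1 \<or> P2 \<subseteq> Q2" using central_factor_subset[OF P' Q Pi(2)] .
    ultimately show False using card central_factor_not_subset[OF Q Qi(1)] by (metis subset_antisym subset_trans)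
  qed
  then show "P1 = Q1" using central_factor_subset[OF Q P Qi(1)] card fin by (metis card_subset_eq)
  have "\<not> Q2 \<subseteq> P1"
    using \<open>P1 = Q1\<close> central_factor_not_subset[OF Q' Qi(2)] by simp
  then show "P2 = Q2" using central_factor_subset[OF Q' P Qi(2)] card fin by (metis card_subset_eq)
qed

text \<open>With \<open>G'\<close> equal to \<open>G\<close> this shows that the factors are
  characteristic; with \<open>G'\<close> the modified group it is the start of the non-isomorphism
  proof.\<close>

lemma iso_central_factors:
  assumes \<phi>: "\<phi> \<in> iso G' G" and P: "central_product G' P1 P2" and Q: "central_product G Q1 Q2"
    and Qi: "centrally_indecomposable (G\<lparr>carrier := Q1\<rparr>)" "centrally_indecomposable (G\<lparr>carrier := Q2\<rparr>)"
    and Pi: "centrally_indecomposable (G'\<lparr>carrier := P1\<rparr>)" "centrally_indecomposable (G'\<lparr>carrier := P2\<rparr>)"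
    and fin: "finite P1" "finite P2"
    and card: "card P1 = card Q1" "card P2 = card Q2" "card Q1 \<noteq> card Q2"
  shows "\<phi> ` P1 = Q1" "\<phi> ` P2 = Q2"
proof -
  interpret group G using Q by (simp add: central_product_def)
  have cp: "central_product G (\<phi> ` P1) (\<phi> ` P2)" by (rule iso_central_product[OF \<phi> P group_axioms])
  then have s: "subgroup (\<phi> ` P1) G" "subgroup (\<phi> ` P2) G" by (auto simp: central_product_def)
  have sub: "P1 \<subseteq> carrier G'" "P2 \<subseteq> carrier G'"
    using P by (auto simp: central_product_def dest: subgroup.subset)
  have inj: "inj_on \<phi> (carrier G')" and hom: "\<phi> \<in> hom G' G" using \<phi> by (auto simp: iso_def bij_betw_def)
  have r: "\<phi> \<in> iso (G'\<lparr>carrier := P\<rparr>) (G\<lparr>carrier := \<phi> ` P\<rparr>)" if "P \<subseteq> carrier G'" for P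
    using that inj_on_subset[OF inj that] hom by (auto simp: iso_def hom_def bij_betw_def subset_iff)
  show "\<phi> ` P1 = Q1" "\<phi> ` P2 = Q2"
    using central_factors_unique[OF Q cp Qi
        iso_centrally_indecomposable[OF r[OF sub(1)] Pi(1) subgroup_imp_group[OF s(1)]]
        iso_centrally_indecomposable[OF r[OF sub(2)] Pi(2) subgroup_imp_group[OF s(2)]]]
      fin card card_image[OF inj_on_subset[OF inj sub(1)]] card_image[OF inj_on_subset[OF inj sub(2)]]
    by auto
qed

section \<open>Amalgamation over a central subgroup of order 3\<close>

text \<open>The subgroup generated by \<open>(a, b\<inverse>)\<close> when \<open>a\<close> and \<open>b\<close> have order 3, so that \<open>b\<^sup>2 = b\<inverse>\<close>.\<close>

definition central_amalgam_kernel :: "('a, 'c) monoid_scheme \<Rightarrow> 'a \<Rightarrow> ('b, 'd) monoid_scheme \<Rightarrow> 'b \<Rightarrow> ('a \<times> 'b) set" where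
  "central_amalgam_kernel A a B b = range (\<lambda>k::nat. (a [^]\<^bsub>A\<^esub> k, b [^]\<^bsub>B\<^esub> (2 * k)))"

lemma (in group) order_3_pow_eq_one:
  assumes "z \<in> carrier G" "z [^] (3::nat) = \<one>" "z \<noteq> \<one>"
  shows "z [^] (k::nat) = \<one> \<longleftrightarrow> 3 dvd k"
proof -
  have "ord z dvd 3" using assms by (simp flip: pow_eq_id)
  moreover have "ord z \<noteq> 1" using assms ord_eq_1 by simp
  moreover have "Factorial_Ring.prime (3::nat)" by simp
  ultimately have "ord z = 3" by (metis prime_nat_iff)
  then show ?thesis using assms(1) by (simp add: pow_eq_id)
qed

text \<open>The group is the quotient of \<open>A \<times>\<times> B\<close> by the central subgroup
  generated by \<open>(a, b\<inverse>)\<close>. That subgroup meets each factor trivially, so both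
  factors embed.\<close>

lemma central_amalgam_exists:
  assumes A: "group A" "finite (carrier A)" and a: "a \<in> carrier A" "a [^]\<^bsub>A\<^esub> (3::nat) = \<one>\<^bsub>A\<^esub>" "a \<noteq> \<one>\<^bsub>A\<^esub>"
    and ac: "\<And>x. x \<in> carrier A \<Longrightarrow> a \<otimes>\<^bsub>A\<^esub> x = x \<otimes>\<^bsub>A\<^esub> a"
    and B: "group B" "finite (carrier B)" and b: "b \<in> carrier B" "b [^]\<^bsub>B\<^esub> (3::nat) = \<one>\<^bsub>B\<^esub>" "b \<noteq> \<one>\<^bsub>B\<^esub>"
    and bc: "\<And>x. x \<in> carrier B \<Longrightarrow> b \<otimes>\<^bsub>B\<^esub> x = x \<otimes>\<^bsub>B\<^esub> b"
  obtains G :: "nat monoid" and i j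
  where "i \<in> hom A G" "inj_on i (carrier A)" "j \<in> hom B G" "inj_on j (carrier B)"
    "central_product G (i ` carrier A) (j ` carrier B)" "i a = j b"
proof -
  interpret A: group A by fact
  interpret B: group B by fact
  let ?P = "A \<times>\<times> B" and ?K = "central_amalgam_kernel A a B b"
  interpret P: group ?P by (intro DirProd_group A B)
  have powA: "x \<otimes>\<^bsub>A\<^esub> a [^]\<^bsub>A\<^esub> k = a [^]\<^bsub>A\<^esub> k \<otimes>\<^bsub>A\<^esub> x" if "x \<in> carrier A" for x and k :: nat
    using A.group_commutes_pow[OF ac[OF that] a(1) that] by simp
  have powB: "x \<otimes>\<^bsub>B\<^esub> b [^]\<^bsub>B\<^esub> k = b [^]\<^bsub>B\<^esub> k \<otimes>\<^bsub>B\<^esub> x" if "x \<in> carrier B" for x and k :: nat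
    using B.group_commutes_pow[OF bc[OF that] b(1) that] by simp
  have central: "x \<otimes>\<^bsub>?P\<^esub> k = k \<otimes>\<^bsub>?P\<^esub> x" if x: "x \<in> carrier ?P" and "k \<in> ?K" for x k
  proof -
    obtain m :: nat where "k = (a [^]\<^bsub>A\<^esub> m, b [^]\<^bsub>B\<^esub> (2 * m))"
      using \<open>k \<in> ?K\<close> unfolding central_amalgam_kernel_def by blast
    moreover obtain y z where "x = (y, z)" "y \<in> carrier A" "z \<in> carrier B" using x by auto
    ultimately show ?thesis by (simp add: powA powB)
  qed
  have Kc: "?K \<subseteq> carrier ?P" using a b by (auto simp: central_amalgam_kernel_def)
  have K: "?K \<lhd> ?P"
  proof (rule P.normal_invI)
    show "subgroup ?K ?P"
    proof (rule P.subgroupI[OF Kc])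
      show "?K \<noteq> {}" by (auto simp: central_amalgam_kernel_def)
    next
      fix x y assume "x \<in> ?K" "y \<in> ?K"
      then obtain k l :: nat where "x = (a [^]\<^bsub>A\<^esub> k, b [^]\<^bsub>B\<^esub> (2 * k))" "y = (a [^]\<^bsub>A\<^esub> l, b [^]\<^bsub>B\<^esub> (2 * l))"
        unfolding central_amalgam_kernel_def by blast
      then have "x \<otimes>\<^bsub>?P\<^esub> y = (a [^]\<^bsub>A\<^esub> (k + l), b [^]\<^bsub>B\<^esub> (2 * (k + l)))"
        using a(1) b(1) by (simp add: A.nat_pow_mult B.nat_pow_mult)
      then show "x \<otimes>\<^bsub>?P\<^esub> y \<in> ?K" unfolding central_amalgam_kernel_def by blast
    next
      fix x assume "x \<in> ?K"
      then obtain k :: nat where x: "x = (a [^]\<^bsub>A\<^esub> k, b [^]\<^bsub>B\<^esub> (2 * k))"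
        unfolding central_amalgam_kernel_def by blast
      \<comment> \<open>Both generators have order 3, so doubling the exponent inverts.\<close>
      let ?y = "(a [^]\<^bsub>A\<^esub> (2 * k), b [^]\<^bsub>B\<^esub> (2 * (2 * k)))"
      have "a [^]\<^bsub>A\<^esub> (2 * k + k) = \<one>\<^bsub>A\<^esub>" "b [^]\<^bsub>B\<^esub> (2 * (2 * k) + 2 * k) = \<one>\<^bsub>B\<^esub>"
        unfolding A.order_3_pow_eq_one[OF a] B.order_3_pow_eq_one[OF b] by presburger+
      then have "?y \<otimes>\<^bsub>?P\<^esub> x = \<one>\<^bsub>?P\<^esub>"
        using a(1) b(1) by (simp only: x mult_DirProd one_DirProd A.nat_pow_mult B.nat_pow_mult)
      then have "inv\<^bsub>?P\<^esub> x = ?y" using a(1) b(1) by (intro P.inv_equality) (auto simp: x)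
      then show "inv\<^bsub>?P\<^esub> x \<in> ?K" unfolding central_amalgam_kernel_def by blast
    qed
  next
    fix x k assume x: "x \<in> carrier ?P" and k: "k \<in> ?K"
    then have "k \<in> carrier ?P" using Kc by blast
    then have "x \<otimes>\<^bsub>?P\<^esub> k \<otimes>\<^bsub>?P\<^esub> inv\<^bsub>?P\<^esub> x = k"
      using P.inv_solve_right'[OF _ P.m_closed[OF x] x] central[OF x k] by blast
    then show "x \<otimes>\<^bsub>?P\<^esub> k \<otimes>\<^bsub>?P\<^esub> inv\<^bsub>?P\<^esub> x \<in> ?K" using k by simp
  qed
  interpret K: normal ?K ?P by (rule K)
  \<comment> \<open>The finitely many cosets are numbered injectively, which places the quotient on
    natural numbers.\<close>
  have "finite ((\<lambda>x. ?K #>\<^bsub>?P\<^esub> x) ` carrier ?P)"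
    by (intro finite_imageI) (simp add: A(2) B(2))
  from finite_imp_inj_to_nat_seg[OF this]
  obtain e :: "_ \<Rightarrow> nat" where e: "inj_on e ((\<lambda>x. ?K #>\<^bsub>?P\<^esub> x) ` carrier ?P)"
    by (elim exE conjE)
  define f where "f x = e (?K #>\<^bsub>?P\<^esub> x)" for x
  have ker: "f x = f y \<longleftrightarrow> x \<otimes>\<^bsub>?P\<^esub> inv\<^bsub>?P\<^esub> y \<in> ?K" if "x \<in> carrier ?P" "y \<in> carrier ?P" for x y
  proof -
    have "f x = f y \<longleftrightarrow> ?K #>\<^bsub>?P\<^esub> x = ?K #>\<^bsub>?P\<^esub> y"
      unfolding f_def using inj_on_eq_iff[OF e] that by blast
    also have "\<dots> \<longleftrightarrow> x \<in> ?K #>\<^bsub>?P\<^esub> y"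
      using that P.rcos_self[OF _ K.subgroup_axioms] P.repr_independence[OF _ _ K.subgroup_axioms] by blast
    also have "\<dots> \<longleftrightarrow> x \<otimes>\<^bsub>?P\<^esub> inv\<^bsub>?P\<^esub> y \<in> ?K"
      using K.rcos_module[OF P.group_axioms that(2,1)] .
    finally show ?thesis .
  qed
  have wm: "weak_group_morphism f ?K ?P" using K ker by (rule weak_group_morphismsI)
  define G where "G = image_group f ?P"
  interpret f: group_hom ?P G f unfolding G_def by (rule P.weak_group_morphism_group_hom[OF wm])
  define i where "i x = f (x, \<one>\<^bsub>B\<^esub>)" for x
  define j where "j y = f (\<one>\<^bsub>A\<^esub>, y)" for y
  have fm: "f (x, y) \<otimes>\<^bsub>G\<^esub> f (x', y') = f (x \<otimes>\<^bsub>A\<^esub> x', y \<otimes>\<^bsub>B\<^esub> y')"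
    if "x \<in> carrier A" "y \<in> carrier B" "x' \<in> carrier A" "y' \<in> carrier B" for x x' y y'
    using that f.hom_mult[of "(x, y)" "(x', y')"] by simp
  have fc: "f (x, y) \<in> carrier G" if "x \<in> carrier A" "y \<in> carrier B" for x y
    using that f.hom_closed[of "(x, y)"] by simp
  have hi: "i \<in> hom A G" and hj: "j \<in> hom B G"
    by (auto simp: hom_def i_def j_def fm fc)
  \<comment> \<open>Since 2 is invertible modulo 3, neither coordinate of a kernel element can be
    trivial alone. This yields injectivity of both embeddings.\<close>
  have K1: "x = \<one>\<^bsub>A\<^esub> \<longleftrightarrow> y = \<one>\<^bsub>B\<^esub>" if "(x, y) \<in> ?K" for x y
  proof -
    obtain k :: nat where k: "x = a [^]\<^bsub>A\<^esub> k" "y = b [^]\<^bsub>B\<^esub> (2 * k)"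
      using \<open>(x, y) \<in> ?K\<close> by (auto simp: central_amalgam_kernel_def)
    have "3 dvd 2 * k \<longleftrightarrow> 3 dvd k" by presburger
    then show ?thesis unfolding k A.order_3_pow_eq_one[OF a] B.order_3_pow_eq_one[OF b] by simp
  qed
  have "inj_on i (carrier A)"
  proof (rule inj_onI)
    fix x y assume xy: "x \<in> carrier A" "y \<in> carrier A" "i x = i y"
    then have "(x \<otimes>\<^bsub>A\<^esub> inv\<^bsub>A\<^esub> y, \<one>\<^bsub>B\<^esub>) \<in> ?K"
      using ker[of "(x, \<one>\<^bsub>B\<^esub>)" "(y, \<one>\<^bsub>B\<^esub>)"] by (simp add: i_def A B)
    then have "x \<otimes>\<^bsub>A\<^esub> inv\<^bsub>A\<^esub> y = \<one>\<^bsub>A\<^esub>" using K1 by blast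
    then show "x = y" using xy by (simp add: A.inv_solve_right')
  qed
  moreover have "inj_on j (carrier B)"
  proof (rule inj_onI)
    fix x y assume xy: "x \<in> carrier B" "y \<in> carrier B" "j x = j y"
    then have "(\<one>\<^bsub>A\<^esub>, x \<otimes>\<^bsub>B\<^esub> inv\<^bsub>B\<^esub> y) \<in> ?K"
      using ker[of "(\<one>\<^bsub>A\<^esub>, x)" "(\<one>\<^bsub>A\<^esub>, y)"] by (simp add: j_def A B)
    then have "x \<otimes>\<^bsub>B\<^esub> inv\<^bsub>B\<^esub> y = \<one>\<^bsub>B\<^esub>" using K1 by blast
    then show "x = y" using xy by (simp add: B.inv_solve_right')
  qed
  moreover have "i a = j b"
  proof -
    have "inv\<^bsub>B\<^esub> b = b [^]\<^bsub>B\<^esub> (2::nat)"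
      using b by (intro B.inv_equality) (simp_all add: numeral_eq_Suc B.m_assoc)
    then have "(a, inv\<^bsub>B\<^esub> b) \<in> ?K" using a unfolding central_amalgam_kernel_def by (intro image_eqI[of _ _ 1]) simp_all
    then show ?thesis using a b ker[of "(a, \<one>\<^bsub>B\<^esub>)" "(\<one>\<^bsub>A\<^esub>, b)"] by (simp add: i_def j_def A B)
  qed
  moreover have "central_product G (i ` carrier A) (j ` carrier B)"
    unfolding central_product_iff
  proof (intro conjI)
    show "group G" ..
    show "subgroup (i ` carrier A) G" "subgroup (j ` carrier B) G"
      using group_hom.img_is_subgroup hi hj f.H.group_axioms A(1) B(1)
      by (auto simp: group_hom_def group_hom_axioms_def)
    have "f (x, y) = i x \<otimes>\<^bsub>G\<^esub> j y" if "x \<in> carrier A" "y \<in> carrier B" for x y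
      using that by (simp add: i_def j_def fm)
    then show "carrier G \<subseteq> i ` carrier A <#>\<^bsub>G\<^esub> j ` carrier B"
      by (force simp: G_def image_group_carrier set_mult_def)
    show "\<forall>h\<in>i ` carrier A. \<forall>k\<in>j ` carrier B. h \<otimes>\<^bsub>G\<^esub> k = k \<otimes>\<^bsub>G\<^esub> h"
      by (auto simp: i_def j_def fm)
  qed
  ultimately show thesis using that hi hj by blast
qed

section \<open>The group in which one factor is replaced by its opposite\<close>

lemma replace_opposite_structure:
  fixes G (structure) and Q1 Q2
  defines "R \<equiv> replace_opposite G Q1 Q2"
  assumes cp: "central_product G Q1 Q2"
  shows "central_product R Q1 Q2"
    and "x \<in> Q1 \<Longrightarrow> y \<in> Q1 \<Longrightarrow> x \<otimes>\<^bsub>R\<^esub> y = y \<otimes> x"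
    and "x \<in> Q2 \<Longrightarrow> y \<in> Q2 \<Longrightarrow> x \<otimes>\<^bsub>R\<^esub> y = x \<otimes> y"
proof -
  interpret group G using cp by (simp add: central_product_def)
  interpret R: group R unfolding R_def by (rule group_replace_opposite[OF cp])
  have s: "subgroup Q1 G" "subgroup Q2 G" using cp by (auto simp: central_product_def)
  interpret Q1: subgroup Q1 G by (rule s)
  interpret Q2: subgroup Q2 G by (rule s)
  have m: "(x \<otimes> y) \<otimes>\<^bsub>R\<^esub> (a \<otimes> b) = (a \<otimes> x) \<otimes> (y \<otimes> b)"
    if "x \<in> Q1" "y \<in> Q2" "a \<in> Q1" "b \<in> Q2" for x y a b
    unfolding R_def by (rule replace_opposite_mult[OF cp that])
  \<comment> \<open>The product of elements of single factors is read off from \<open>m\<close> by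
    taking the missing components to be \<open>\<one>\<close>.\<close>
  have m1: "x \<otimes>\<^bsub>R\<^esub> y = y \<otimes> x" if "x \<in> Q1" "y \<in> Q1" for x y
    using m[of x \<one> y \<one>] that by simp
  have m2: "x \<otimes>\<^bsub>R\<^esub> y = x \<otimes> y" if "x \<in> Q2" "y \<in> Q2" for x y
    using m[of \<one> x \<one> y] that by simp
  have m12: "x \<otimes>\<^bsub>R\<^esub> y = x \<otimes> y" "y \<otimes>\<^bsub>R\<^esub> x = x \<otimes> y" if "x \<in> Q1" "y \<in> Q2" for x y
    using m[of x \<one> \<one> y] m[of \<one> y x \<one>] that by simp_all
  have cR: "carrier R = carrier G" and oR: "\<one>\<^bsub>R\<^esub> = \<one>" by (simp_all add: R_def)
  have i1: "inv\<^bsub>R\<^esub> x = inv x" if "x \<in> Q1" for x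
    using that by (intro R.inv_equality) (simp_all add: m1 cR oR)
  have i2: "inv\<^bsub>R\<^esub> x = inv x" if "x \<in> Q2" for x
    using that by (intro R.inv_equality) (simp_all add: m2 cR oR)
  have "subgroup Q1 R"
    using Q1.subset subgroupE(2)[OF s(1)] by (intro R.subgroupI) (auto simp: cR i1 m1)
  moreover have "subgroup Q2 R"
    using Q2.subset subgroupE(2)[OF s(2)] by (intro R.subgroupI) (auto simp: cR i2 m2)
  moreover have "carrier R \<subseteq> Q1 <#>\<^bsub>R\<^esub> Q2"
    using cp by (auto simp: cR central_product_def set_mult_def m12)
  ultimately show "central_product R Q1 Q2"
    by (simp add: central_product_iff R.group_axioms m12)
  show "x \<in> Q1 \<Longrightarrow> y \<in> Q1 \<Longrightarrow> x \<otimes>\<^bsub>R\<^esub> y = y \<otimes> x" by (rule m1)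
  show "x \<in> Q2 \<Longrightarrow> y \<in> Q2 \<Longrightarrow> x \<otimes>\<^bsub>R\<^esub> y = x \<otimes> y" by (rule m2)
qed

definition aut_fixed :: "('a, 'c) monoid_scheme \<Rightarrow> 'a \<Rightarrow> bool" where
  "aut_fixed G z \<longleftrightarrow> (\<forall>\<psi> \<in> iso G G. \<psi> z = z)"

text \<open>Conjugating an automorphism of \<open>B\<close> by \<open>f\<close> gives an
  automorphism of \<open>A\<close>.\<close>

lemma iso_aut_fixed:
  assumes A: "group A" and f: "f \<in> iso A B" and z: "z \<in> carrier A" "aut_fixed A z"
  shows "aut_fixed B (f z)"
  unfolding aut_fixed_def
proof
  fix \<psi> assume \<psi>: "\<psi> \<in> iso B B"
  have "inv_into (carrier A) f \<circ> (\<psi> \<circ> f) \<in> iso A A"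
    by (rule iso_set_trans[OF iso_set_trans[OF f \<psi>] group.iso_set_sym[OF A f]])
  then have "inv_into (carrier A) f (\<psi> (f z)) = z" using z(2) by (auto simp: aut_fixed_def)
  moreover have "\<psi> (f z) \<in> f ` carrier A"
    using f \<psi> z(1) by (auto simp: iso_def bij_betw_def)
  ultimately show "\<psi> (f z) = f z" by (metis f_inv_into_f)
qed

text \<open>In the amalgam \<open>a\<close> and \<open>b\<close> become a single element
  \<open>z\<close>, so the automorphisms of both factors constrain the same
  \<open>z\<close>.\<close>

lemma central_amalgam_replace_opposite:
  assumes A: "finite (carrier A)" "centrally_indecomposable A"
    and a: "a \<in> carrier A" "a [^]\<^bsub>A\<^esub> (3::nat) = \<one>\<^bsub>A\<^esub>" "a \<noteq> \<one>\<^bsub>A\<^esub>" "aut_fixed A a"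
    and ac: "\<And>x. x \<in> carrier A \<Longrightarrow> a \<otimes>\<^bsub>A\<^esub> x = x \<otimes>\<^bsub>A\<^esub> a"
    and B: "finite (carrier B)" "centrally_indecomposable B"
    and b: "b \<in> carrier B" "b [^]\<^bsub>B\<^esub> (3::nat) = \<one>\<^bsub>B\<^esub>" "b \<noteq> \<one>\<^bsub>B\<^esub>" "aut_fixed B b"
    and bc: "\<And>x. x \<in> carrier B \<Longrightarrow> b \<otimes>\<^bsub>B\<^esub> x = x \<otimes>\<^bsub>B\<^esub> b"
    and card: "card (carrier A) \<noteq> card (carrier B)"
  shows "\<exists>(G :: nat monoid) Q1 Q2.
    central_product G Q1 Q2 \<and>
    finite Q1 \<and> perfect_group (G\<lparr>carrier := Q1\<rparr>) \<and> centrally_indecomposable (G\<lparr>carrier := Q1\<rparr>) \<and>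
    finite Q2 \<and> perfect_group (G\<lparr>carrier := Q2\<rparr>) \<and> centrally_indecomposable (G\<lparr>carrier := Q2\<rparr>) \<and>
    characteristic_subgroup Q1 G \<and> characteristic_subgroup Q2 G \<and>
    \<not> replace_opposite G Q1 Q2 \<cong> G \<and>
    characteristic_subgroup Q1 (replace_opposite G Q1 Q2) \<and>
    characteristic_subgroup Q2 (replace_opposite G Q1 Q2)"
proof -
  have gA: "group A" and gB: "group B"
    using A(2) B(2) by (auto simp: centrally_indecomposable_def perfect_group_def)
  obtain G :: "nat monoid" and i j
    where i: "i \<in> hom A G" "inj_on i (carrier A)" and j: "j \<in> hom B G" "inj_on j (carrier B)"
      and cp: "central_product G (i ` carrier A) (j ` carrier B)" and ij: "i a = j b"
    by (rule central_amalgam_exists[OF gA A(1) a(1-3) ac gB B(1) b(1-3) bc])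
  define Q1 where "Q1 = i ` carrier A"
  define Q2 where "Q2 = j ` carrier B"
  define z where "z = i a"
  note cp = cp[folded Q1_def Q2_def]
  interpret group G using cp by (simp add: central_product_def)
  have s: "subgroup Q1 G" "subgroup Q2 G" using cp by (auto simp: central_product_def)
  interpret Q1: subgroup Q1 G by (rule s)
  interpret Q2: subgroup Q2 G by (rule s)
  have fin: "finite Q1" "finite Q2" using A(1) B(1) by (simp_all add: Q1_def Q2_def)
  have cardQ: "card Q1 \<noteq> card Q2" using card i(2) j(2) by (simp add: Q1_def Q2_def card_image)
  have isoA: "i \<in> iso A (G\<lparr>carrier := Q1\<rparr>)"
    using i by (auto simp: iso_def hom_def bij_betw_def Q1_def)
  have isoB: "j \<in> iso B (G\<lparr>carrier := Q2\<rparr>)"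
    using j by (auto simp: iso_def hom_def bij_betw_def Q2_def)
  have ind1: "centrally_indecomposable (G\<lparr>carrier := Q1\<rparr>)"
    by (rule iso_centrally_indecomposable[OF isoA A(2) subgroup_imp_group[OF s(1)]])
  have ind2: "centrally_indecomposable (G\<lparr>carrier := Q2\<rparr>)"
    by (rule iso_centrally_indecomposable[OF isoB B(2) subgroup_imp_group[OF s(2)]])
  have fix1: "aut_fixed (G\<lparr>carrier := Q1\<rparr>) z"
    unfolding z_def by (rule iso_aut_fixed[OF gA isoA a(1,4)])
  have fix2: "aut_fixed (G\<lparr>carrier := Q2\<rparr>) z"
    unfolding z_def ij by (rule iso_aut_fixed[OF gB isoB b(1,4)])
  have z: "z \<in> Q1" "z \<in> Q2" using a(1) b(1) by (auto simp: z_def Q1_def) (auto simp: ij Q2_def)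
  interpret i: group_hom A G i using i(1) gA by (simp add: group_hom_def group_hom_axioms_def)
  have z3: "z [^]\<^bsub>G\<^esub> (3::nat) = \<one>\<^bsub>G\<^esub>"
    using i.hom_nat_pow[OF a(1), of 3] a(2) by (simp add: z_def)
  have z1: "z \<noteq> \<one>\<^bsub>G\<^esub>"
    using inj_onD[OF i(2), of a "\<one>\<^bsub>A\<^esub>"] a(1,3) by (auto simp: z_def)
  define R where "R = replace_opposite G Q1 Q2"
  note R = replace_opposite_structure[OF cp, folded R_def]
  interpret R: group R unfolding R_def by (rule group_replace_opposite[OF cp])
  have sR: "subgroup Q1 R" "subgroup Q2 R" using R(1) by (auto simp: central_product_def)
  \<comment> \<open>Inversion is an isomorphism from \<open>Q1\<close> onto its opposite, so
    indecomposability carries over to the modified group.\<close>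
  have "(\<lambda>x. inv\<^bsub>G\<^esub> x) ` Q1 = Q1"
    by (force intro: image_eqI[of _ _ "inv\<^bsub>G\<^esub> x" for x])
  then have "(\<lambda>x. inv\<^bsub>G\<^esub> x) \<in> iso (G\<lparr>carrier := Q1\<rparr>) (R\<lparr>carrier := Q1\<rparr>)"
    by (auto simp: iso_def hom_def bij_betw_def R(2) inv_mult_group intro!: inj_onI dest: inv_inj[THEN inj_onD])
  then have indR1: "centrally_indecomposable (R\<lparr>carrier := Q1\<rparr>)"
    by (rule iso_centrally_indecomposable[OF _ ind1 R.subgroup_imp_group[OF sR(1)]])
  have "(\<lambda>x. x) \<in> iso (G\<lparr>carrier := Q2\<rparr>) (R\<lparr>carrier := Q2\<rparr>)"
    by (auto simp: iso_def hom_def bij_betw_def R(3))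
  then have indR2: "centrally_indecomposable (R\<lparr>carrier := Q2\<rparr>)"
    by (rule iso_centrally_indecomposable[OF _ ind2 R.subgroup_imp_group[OF sR(2)]])
  note factors = iso_central_factors[OF _ _ _ _ _ _ _ fin refl refl cardQ]
  have "characteristic_subgroup Q1 G" "characteristic_subgroup Q2 G"
    using factors[OF _ cp cp ind1 ind2 ind1 ind2] s by (simp_all add: characteristic_subgroup_def)
  moreover have "characteristic_subgroup Q1 R" "characteristic_subgroup Q2 R"
    using factors[OF _ R(1) R(1) indR1 indR2 indR1 indR2] sR by (simp_all add: characteristic_subgroup_def)
  moreover have "\<not> R \<cong> G"
  proof
    assume "R \<cong> G"
    then obtain \<phi> where \<phi>: "\<phi> \<in> iso R G" by (auto simp: is_iso_def)
    note im = factors[OF \<phi> R(1) cp ind1 ind2 indR1 indR2]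
    have inj: "inj_on \<phi> (carrier R)" using \<phi> by (auto simp: iso_def bij_betw_def)
    have cR: "carrier R = carrier G" by (simp add: R_def)
    have h: "\<phi> (x \<otimes>\<^bsub>R\<^esub> y) = \<phi> x \<otimes>\<^bsub>G\<^esub> \<phi> y" if "x \<in> carrier G" "y \<in> carrier G" for x y
      using \<phi> that by (auto simp: iso_def hom_def cR)
    have mem: "\<phi> x \<in> Q1" if "x \<in> Q1" for x using im(1) that by blast
    have mem2: "\<phi> x \<in> Q2" if "x \<in> Q2" for x using im(2) that by blast
    have inj1: "inj_on \<phi> Q1" and inj2: "inj_on \<phi> Q2"
      using inj_on_subset[OF inj] Q1.subset Q2.subset by (auto simp: cR)
    \<comment> \<open>Products within \<open>Q2\<close> are the same in \<open>R\<close> and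
      \<open>G\<close>, so \<open>\<phi>\<close> restricts to an automorphism of \<open>Q2\<close>
      and fixes \<open>z\<close>.\<close>
    have "\<phi> (x \<otimes>\<^bsub>G\<^esub> y) = \<phi> x \<otimes>\<^bsub>G\<^esub> \<phi> y" if "x \<in> Q2" "y \<in> Q2" for x y
      using h[of x y] R(3)[OF that] that by simp
    then have "\<phi> \<in> iso (G\<lparr>carrier := Q2\<rparr>) (G\<lparr>carrier := Q2\<rparr>)"
      using im(2) inj2 by (auto simp: iso_def hom_def bij_betw_def mem2)
    then have \<phi>z: "\<phi> z = z" using fix2 by (simp add: aut_fixed_def)
    \<comment> \<open>On \<open>Q1\<close> the map \<open>\<phi>\<close> reverses products. Followed
      by inversion it is an automorphism of \<open>Q1\<close> and fixes \<open>z\<close>; with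
      \<open>\<phi> z = z\<close> this makes \<open>z\<close> its own inverse, against order
      3.\<close>
    have "\<phi> (x \<otimes>\<^bsub>G\<^esub> y) = \<phi> y \<otimes>\<^bsub>G\<^esub> \<phi> x" if "x \<in> Q1" "y \<in> Q1" for x y
      using h[of y x] R(2)[OF that(2,1)] that by simp
    then have m: "inv\<^bsub>G\<^esub> \<phi> (x \<otimes>\<^bsub>G\<^esub> y) = inv\<^bsub>G\<^esub> \<phi> x \<otimes>\<^bsub>G\<^esub> inv\<^bsub>G\<^esub> \<phi> y" if "x \<in> Q1" "y \<in> Q1" for x y
      using that by (simp add: inv_mult_group mem)
    have "inj_on (\<lambda>x. inv\<^bsub>G\<^esub> \<phi> x) Q1"
    proof (rule inj_onI)
      fix x y assume xy: "x \<in> Q1" "y \<in> Q1" "inv\<^bsub>G\<^esub> \<phi> x = inv\<^bsub>G\<^esub> \<phi> y"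
      then have "\<phi> x = \<phi> y" using mem by (metis Q1.mem_carrier inv_inv)
      then show "x = y" using inj1 xy by (simp add: inj_on_eq_iff)
    qed
    moreover have "(\<lambda>x. inv\<^bsub>G\<^esub> \<phi> x) ` Q1 = Q1"
      using endo_inj_surj[OF fin(1) _ calculation] mem by blast
    ultimately have "(\<lambda>x. inv\<^bsub>G\<^esub> \<phi> x) \<in> iso (G\<lparr>carrier := Q1\<rparr>) (G\<lparr>carrier := Q1\<rparr>)"
      by (auto simp: iso_def hom_def bij_betw_def m mem)
    then have "inv\<^bsub>G\<^esub> z = z" using fix1 \<phi>z by (force simp: aut_fixed_def)
    then have "z \<otimes>\<^bsub>G\<^esub> z = \<one>\<^bsub>G\<^esub>" using z(1) by (metis Q1.mem_carrier l_inv)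
    then have "z [^]\<^bsub>G\<^esub> (3::nat) = z" using z(1) by (simp add: numeral_eq_Suc)
    with z3 z1 show False by simp
  qed
  ultimately show ?thesis
    using cp fin ind1 ind2 unfolding R_def centrally_indecomposable_def by blast
qed

section \<open>A group whose automorphisms fix a central element of order 3\<close>

text \<open>The type \<open>19\<close> is the ring of integers modulo 19. Since 19 is prime, Bezout
  coefficients provide inverses.\<close>

lemma Z19_unit: fixes a :: 19 assumes "a \<noteq> 0" shows "\<exists>c. c * a = 1"
proof (cases a)
  case (of_int z)
  then have z: "0 < z" "z < 19" using assms by (auto simp: order_le_less)
  have "Factorial_Ring.prime (19::int)" by simp
  moreover have "\<not> 19 dvd z" using z zdvd_imp_le by fastforce
  ultimately have "coprime 19 z" by (rule prime_imp_coprime)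
  then obtain c d where cd: "c * 19 + d * z = 1" using bezout_int[of 19 z] by auto
  have "(19::19) = 0" by simp
  then have "of_int d * of_int z = (of_int (c * 19 + d * z) :: 19)"
    by (simp only: of_int_add of_int_mult of_int_numeral mult_zero_right add_0_left)
  then have "of_int d * a = 1" unfolding of_int(1) cd by (simp only: of_int_1)
  then show ?thesis by blast
qed

lemma Z19_mult_eq_0: fixes a b :: 19 shows "a * b = 0 \<longleftrightarrow> a = 0 \<or> b = 0"
proof
  assume ab: "a * b = 0"
  show "a = 0 \<or> b = 0"
  proof (rule disjCI)
    assume "b \<noteq> 0"
    then obtain c where "c * b = 1" using Z19_unit by blast
    then have "a = a * b * c" by (simp add: mult.assoc mult.commute[of b c])
    then show "a = 0" using ab by simp
  qed
qed auto

text \<open>A prime field is additively generated by any nonzero element, so closure under addition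
  will already give closure under scalars.\<close>

lemma Z19_multiple: fixes a b :: 19 assumes "a \<noteq> 0" shows "\<exists>m::nat. b = of_nat m * a"
proof -
  obtain c where c: "c * a = 1" using Z19_unit[OF assms] by blast
  obtain z where z: "b * c = of_int z" "0 \<le> z" by (cases "b * c") auto
  have "b = b * c * a" using c by (simp add: mult.assoc)
  then have "b = of_nat (nat z) * a" using z by simp
  then show ?thesis by blast
qed

section \<open>The alternating group, generated by 3-cycles\<close>

definition cyc3 :: "'i \<Rightarrow> 'i \<Rightarrow> 'i \<Rightarrow> 'i \<Rightarrow> 'i" where
  "cyc3 a b c i = (if i = a then b else if i = b then c else if i = c then a else i)"

text \<open>
  This is the alternating group. Generation by 3-cycles is all that is needed of it, so parity does
  not enter.
\<close>

inductive_set cyc3_group :: "('i \<Rightarrow> 'i) set" where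
  id: "id \<in> cyc3_group"
| step: "s \<in> cyc3_group \<Longrightarrow> distinct [a, b, c] \<Longrightarrow> s \<circ> cyc3 a b c \<in> cyc3_group"

lemma cyc3_in_group: "distinct [a, b, c] \<Longrightarrow> cyc3 a b c \<in> cyc3_group"
  using cyc3_group.step[OF cyc3_group.id, of a b c] by simp

lemma cyc3_group_comp: "t \<in> cyc3_group \<Longrightarrow> s \<in> cyc3_group \<Longrightarrow> s \<circ> t \<in> cyc3_group"
  by (induction rule: cyc3_group.induct) (auto simp: comp_assoc[symmetric] intro: cyc3_group.step)

lemma cyc3_inverse:
  assumes "distinct [a, b, c]"
  shows "cyc3 a c b \<circ> cyc3 a b c = id" "cyc3 a b c \<circ> cyc3 a c b = id"
  using assms by (auto simp: cyc3_def fun_eq_iff)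

lemma cyc3_group_inverse:
  "s \<in> cyc3_group \<Longrightarrow> \<exists>t \<in> cyc3_group. t \<circ> s = id \<and> s \<circ> t = id"
proof (induction rule: cyc3_group.induct)
  case id
  show ?case by (rule bexI[OF _ cyc3_group.id]) simp
next
  case (step s a b c)
  then obtain t where t: "t \<in> cyc3_group" "t \<circ> s = id" "s \<circ> t = id" by blast
  note inv = cyc3_inverse[OF step(2)]
  have "(cyc3 a c b \<circ> t) \<circ> (s \<circ> cyc3 a b c) = cyc3 a c b \<circ> (t \<circ> s) \<circ> cyc3 a b c"
    "(s \<circ> cyc3 a b c) \<circ> (cyc3 a c b \<circ> t) = s \<circ> (cyc3 a b c \<circ> cyc3 a c b) \<circ> t"
    by (simp_all only: comp_assoc)
  then have "(cyc3 a c b \<circ> t) \<circ> (s \<circ> cyc3 a b c) = id" "(s \<circ> cyc3 a b c) \<circ> (cyc3 a c b \<circ> t) = id"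
    by (simp_all only: t inv comp_id)
  moreover have "cyc3 a c b \<circ> t \<in> cyc3_group"
    using step(2) t(1) by (intro cyc3_group_comp cyc3_in_group) auto
  ultimately show ?case by blast
qed

lemma cyc3_group_bij: "s \<in> cyc3_group \<Longrightarrow> bij s"
  using cyc3_group_inverse o_bij by blast

section \<open>The group \<open>F\<^sup>n \<rtimes> (D \<rtimes> A\<^sub>n)\<close>\<close>

text \<open>The components are a translation, the diagonal entries of a matrix in \<open>D\<close>,
  and a permutation; the index type supplies \<open>n = CARD('i)\<close>.\<close>

type_synonym 'i chiral = "('i \<Rightarrow> 19) \<times> ('i \<Rightarrow> 19) \<times> ('i \<Rightarrow> 'i)"

text \<open>
  The permutation \<open>s\<close> in \<open>(x, u, s)\<close> acts contravariantly, by \<open>y \<mapsto> y \<circ> s\<close>; this avoids inverses in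
  the product and is why the last components are composed in reverse order.
\<close>

definition chiral_group :: "('i::finite) chiral monoid" where
  "chiral_group =
     \<lparr>carrier = {(x, u, s). (\<forall>i. u i ^ 9 = 1) \<and> (\<Prod>i\<in>UNIV. u i) = 1 \<and> s \<in> cyc3_group},
      monoid.mult = (\<lambda>(x, u, s) (y, v, t).
        (\<lambda>i. x i + u i ^ 3 * y (s i), \<lambda>i. u i * v (s i), t \<circ> s)),
      one = (\<lambda>_. 0, \<lambda>_. 1, id)\<rparr>"

lemma chiral_mult [simp]:
  "(x, u, s) \<otimes>\<^bsub>chiral_group\<^esub> (y, v, t) =
   (\<lambda>i. x i + u i ^ 3 * y (s i), \<lambda>i. u i * v (s i), t \<circ> s)"
  by (simp add: chiral_group_def)

lemma chiral_one [simp]: "\<one>\<^bsub>chiral_group\<^esub> = (\<lambda>_. 0, \<lambda>_. 1, id)"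
  by (simp add: chiral_group_def)

lemma chiral_carrier:
  "(x, u, s) \<in> carrier chiral_group \<longleftrightarrow> (\<forall>i. u i ^ 9 = 1) \<and> (\<Prod>i\<in>UNIV. u i) = 1 \<and> s \<in> cyc3_group"
  by (simp add: chiral_group_def)

lemma prod_comp_bij: "bij s \<Longrightarrow> (\<Prod>i\<in>UNIV. f (s i)) = (\<Prod>i\<in>UNIV. f i)"
  using prod.reindex_bij_betw[of s UNIV UNIV f] by simp

lemma group_chiral: "group (chiral_group :: ('i::finite) chiral monoid)"
proof (rule groupI, goal_cases)
  case (1 g h)
  then show ?case
    by (cases g; cases h)
      (auto simp: chiral_carrier power_mult_distrib prod.distrib prod_comp_bij[OF cyc3_group_bij]
        intro: cyc3_group_comp)
next
  case 2
  then show ?case by (simp add: chiral_carrier cyc3_group.id)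
next
  case (3 g h k)
  then show ?case
    by (cases g; cases h; cases k) (simp add: power_mult_distrib distrib_left mult.assoc add.assoc comp_assoc)
next
  case (4 g)
  then show ?case by (cases g) simp
next
  case (5 g)
  obtain x u s where g: "g = (x, u, s)" by (cases g)
  with 5 have u: "\<And>i. u i ^ 9 = 1" "(\<Prod>i\<in>UNIV. u i) = 1" and s: "s \<in> cyc3_group"
    by (auto simp: chiral_carrier)
  obtain t where t: "t \<in> cyc3_group" "t \<circ> s = id" "s \<circ> t = id" using cyc3_group_inverse[OF s] by blast
  \<comment> \<open>For a ninth root of unity the eighth power is the inverse; the index is moved by
    \<open>t\<close>, the inverse of \<open>s\<close>.\<close>
  let ?v = "\<lambda>i. u (t i) ^ 8"
  have v: "?v i ^ 9 = 1" for i
  proof -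
    have "?v i ^ 9 = (u (t i) ^ 9) ^ 8" by (simp flip: power_mult)
    then show ?thesis by (simp only: u power_one)
  qed
  have "(\<Prod>i\<in>UNIV. ?v i) = 1"
    using u(2) by (simp add: prod_power_distrib[symmetric] prod_comp_bij[OF cyc3_group_bij[OF t(1)]])
  then have "(\<lambda>i. - (?v i ^ 3 * x (t i)), ?v, t) \<in> carrier chiral_group"
    using t v by (simp add: chiral_carrier)
  moreover have "?v i * u (t i) = 1" for i
    using u(1)[of "t i"] by (simp add: power_Suc2[symmetric] del: power_Suc)
  then have "(\<lambda>i. - (?v i ^ 3 * x (t i)), ?v, t) \<otimes>\<^bsub>chiral_group\<^esub> g = \<one>\<^bsub>chiral_group\<^esub>"
    unfolding g using t(3) by (simp only: chiral_mult chiral_one) simp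
  ultimately show ?case by blast
qed

abbreviation vec :: "('i \<Rightarrow> 19) \<Rightarrow> 'i chiral" where "vec x \<equiv> (x, \<lambda>_. 1, id)"
abbreviation diag :: "('i \<Rightarrow> 19) \<Rightarrow> 'i chiral" where "diag u \<equiv> (\<lambda>_. 0, u, id)"
abbreviation perm :: "('i \<Rightarrow> 'i) \<Rightarrow> 'i chiral" where "perm s \<equiv> (\<lambda>_. 0, \<lambda>_. 1, s)"

definition spike :: "'i \<Rightarrow> 19 \<Rightarrow> 'i \<Rightarrow> 19" where
  "spike i b k = (if k = i then b else 0)"

text \<open>For \<open>v ^ 9 = 1\<close> the entry \<open>v ^ 8\<close> is the inverse of
  \<open>v\<close>, so the determinant is 1. These matrices generate \<open>D\<close>.\<close>

definition ratio :: "'i \<Rightarrow> 'i \<Rightarrow> 19 \<Rightarrow> 'i \<Rightarrow> 19" where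
  "ratio i j v k = (if k = i then v else if k = j then v ^ 8 else 1)"

lemma Z19_ninth_root_power: "(v::19) ^ 9 = 1 \<Longrightarrow> (v ^ m) ^ 9 = 1"
proof -
  assume v: "v ^ 9 = 1"
  have "(v ^ m) ^ 9 = (v ^ 9) ^ m" by (simp flip: power_mult add: mult.commute)
  then show ?thesis by (simp only: v power_one)
qed

lemma vec_in_carrier: "vec x \<in> carrier chiral_group"
  by (simp add: chiral_carrier cyc3_group.id)

lemma perm_in_carrier: "s \<in> cyc3_group \<Longrightarrow> perm s \<in> carrier chiral_group"
  by (simp add: chiral_carrier)

lemma diag_in_carrier: "(\<And>i. u i ^ 9 = 1) \<Longrightarrow> (\<Prod>i\<in>UNIV. u i) = 1 \<Longrightarrow> diag u \<in> carrier chiral_group"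
  by (simp add: chiral_carrier cyc3_group.id)

lemma ratio_in_carrier:
  assumes "i \<noteq> j" "v ^ 9 = 1" shows "diag (ratio i j v) \<in> carrier chiral_group"
proof (rule diag_in_carrier)
  show "ratio i j v k ^ 9 = 1" for k using assms Z19_ninth_root_power[OF assms(2), of 8] by (auto simp: ratio_def)
  have "(\<Prod>k\<in>UNIV. ratio i j v k) = (\<Prod>k\<in>{i, j}. ratio i j v k)"
    by (rule prod.mono_neutral_right) (auto simp: ratio_def)
  also have "\<dots> = v ^ 9" using assms(1) by (simp add: ratio_def flip: power_Suc)
  finally show "(\<Prod>k\<in>UNIV. ratio i j v k) = 1" using assms(2) by simp
qed

text \<open>The scalars by which \<open>diag (ratio i j 4)\<close> acts on the coordinates. Modulo
  19 the number 4 has order 9, and \<open>4 ^ 3 = 7\<close> and its inverse 11 are the primitive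
  cube roots of unity.\<close>

lemma ratio_4_cubed:
  "ratio i j 4 i ^ 3 = 7" "i \<noteq> j \<Longrightarrow> ratio i j 4 j ^ 3 = 11"
  "k \<notin> {i, j} \<Longrightarrow> ratio i j 4 k ^ 3 = 1"
  by (simp_all add: ratio_def)

text \<open>The scalar \<open>c\<close> has determinant \<open>c ^ CARD('i)\<close>; divisibility of
  the dimension by 9 makes it 1.\<close>

lemma diag_const_in_carrier:
  assumes "c ^ 9 = 1" "9 dvd CARD('i)"
  shows "diag (\<lambda>_ :: 'i::finite. c) \<in> carrier chiral_group"
proof -
  obtain k where "CARD('i) = 9 * k" using assms(2) by (rule dvdE)
  then have "c ^ CARD('i) = 1" by (simp only: power_mult assms(1) power_one)
  then show ?thesis using assms by (intro diag_in_carrier) simp_all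
qed

lemma chiral_decompose:
  "(x, u, s) = vec x \<otimes>\<^bsub>chiral_group\<^esub> (diag u \<otimes>\<^bsub>chiral_group\<^esub> perm s)"
  by simp

text \<open>There are at least nine indices. This supplies the spare ones that the 3-cycles and the
  matrices \<open>ratio i j v\<close> call for.\<close>

lemma ex_not_in_short_list:
  assumes "9 dvd CARD('i::finite)" "length xs < 5" shows "\<exists>i :: 'i. i \<notin> set xs"
proof (rule ccontr)
  assume "\<nexists>i. i \<notin> set xs"
  then have "set xs = UNIV" by blast
  then have "CARD('i) < 5" using card_length[of xs] assms(2) by simp
  then show False using assms(1) zero_less_card_finite[where 'a='i] by (auto dest!: dvd_imp_le)
qed

lemma vec_add_closed:
  assumes "subgroup D chiral_group" "vec x \<in> D" "vec y \<in> D" shows "vec (\<lambda>i. x i + y i) \<in> D"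
  using subgroup.m_closed[OF assms] by simp

lemma diag_mult_closed:
  assumes "subgroup D chiral_group" "diag u \<in> D" "diag v \<in> D" shows "diag (\<lambda>i. u i * v i) \<in> D"
  using subgroup.m_closed[OF assms] by simp

lemma vec_from_spikes:
  assumes D: "subgroup D chiral_group" and sp: "\<And>i b. vec (spike i b) \<in> D"
  shows "vec (x :: 'i::finite \<Rightarrow> 19) \<in> D"
proof -
  let ?w = "\<lambda>A k. if k \<in> A then x k else 0"
  have "vec (?w A) \<in> D" if "finite A" for A :: "'i set"
    using that
  proof induction
    case empty
    then show ?case using subgroup.one_closed[OF D] by (simp only: chiral_one empty_iff if_False)
  next
    case (insert i A)
    have "?w (insert i A) = (\<lambda>k. spike i (x i) k + ?w A k)"
      using insert.hyps by (intro ext) (auto simp: spike_def)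
    then show ?case using vec_add_closed[OF D sp insert.IH] by (simp only:)
  qed
  from this[of UNIV] show ?thesis by simp
qed

text \<open>Multiply the matrices \<open>ratio i j (u i)\<close> over all \<open>i\<close> other
  than \<open>j\<close>. The entry at \<open>j\<close> becomes the inverse of the product of the
  other entries, which is \<open>u j\<close> because the determinant is 1.\<close>

lemma diag_from_ratios:
  assumes D: "subgroup D chiral_group" and u: "\<And>i. u i ^ 9 = 1" "(\<Prod>i\<in>UNIV. u i) = 1"
    and ra: "\<And>i. i \<noteq> j \<Longrightarrow> diag (ratio i j (u i)) \<in> D"
  shows "diag (u :: 'i::finite \<Rightarrow> 19) \<in> D"
proof -
  let ?w = "\<lambda>A k. if k \<in> A then u k else if k = j then (\<Prod>i\<in>A. u i) ^ 8 else 1"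
  have *: "diag (?w A) \<in> D" if "finite A" "j \<notin> A" for A :: "'i set"
    using that
  proof induction
    case empty
    have "?w {} = (\<lambda>_. 1)" by auto
    then show ?case using subgroup.one_closed[OF D] by (simp only: chiral_one)
  next
    case (insert i A)
    then have ij: "i \<noteq> j" "j \<notin> A" by auto
    have "?w (insert i A) = (\<lambda>k. ratio i j (u i) k * ?w A k)"
      using insert.hyps ij by (intro ext) (simp add: ratio_def power_mult_distrib)
    then show ?case using diag_mult_closed[OF D ra[OF ij(1)] insert.IH[OF ij(2)]] by (simp only:)
  qed
  have "diag (?w (UNIV - {j})) \<in> D" by (rule *) auto
  moreover have "?w (UNIV - {j}) k = u k" for k
  proof (cases "k = j")
    case True
    let ?p = "\<Prod>i\<in>UNIV - {j}. u i"
    have "?p ^ 9 = 1" by (simp add: prod_power_distrib u)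
    moreover have "u j * ?p = 1" using u(2) by (simp add: prod.remove[of UNIV j])
    moreover have "u j * ?p * ?p ^ 8 = u j * ?p ^ 9" by (simp add: mult.assoc flip: power_Suc)
    ultimately have "?p ^ 8 = u j" by (simp only: mult_1_left mult_1_right)
    then show ?thesis using True by simp
  qed simp
  then have "?w (UNIV - {j}) = u" by (rule ext)
  ultimately show ?thesis by (simp only:)
qed

section \<open>Perfectness\<close>

text \<open>Exhibits a 3-cycle as the commutator of two 3-cycles with one common point
  \<open>b\<close>, the usual reason why alternating groups on at least five points are perfect. The
  order of composition fits the contravariant product.\<close>

lemma cyc3_commutator:
  assumes "distinct [a, b, c, d, e]"
  shows "cyc3 b e c \<circ> cyc3 a b d = cyc3 a b d \<circ> cyc3 b e c \<circ> cyc3 a b c"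
proof
  fix m
  have "m = a \<or> m = b \<or> m = c \<or> m = d \<or> m = e \<or> m \<notin> {a, b, c, d, e}" by blast
  moreover have "a \<noteq> b" "a \<noteq> c" "a \<noteq> d" "a \<noteq> e" "b \<noteq> c" "b \<noteq> d" "b \<noteq> e" "c \<noteq> d" "c \<noteq> e" "d \<noteq> e"
    using assms by auto
  ultimately show "(cyc3 b e c \<circ> cyc3 a b d) m = (cyc3 a b d \<circ> cyc3 b e c \<circ> cyc3 a b c) m"
    by (elim disjE) (simp_all add: cyc3_def)
qed

text \<open>Each layer consists of products of commutators: 3-cycles from 3-cycles,
  \<open>ratio\<close> matrices from a 3-cycle and a \<open>ratio\<close> matrix, and multiples of
  unit vectors from a \<open>ratio\<close> matrix and a vector.\<close>

lemma perfect_chiral: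
  assumes n: "9 dvd CARD('i::finite)"
  shows "perfect_group (chiral_group :: 'i chiral monoid)"
proof -
  let ?G = "chiral_group :: 'i chiral monoid"
  interpret group ?G by (rule group_chiral)
  define D where "D = derived ?G (carrier ?G)"
  have D: "subgroup D ?G" unfolding D_def by (rule derived_is_subgroup) simp
  note com = commutator_in_derived[folded D_def]
  note out = ex_not_in_short_list[OF n]
  have perm: "perm s \<in> D" if "s \<in> cyc3_group" for s :: "'i \<Rightarrow> 'i"
    using that
  proof induction
    case id
    show ?case using subgroup.one_closed[OF D] by (simp add: id_def)
  next
    case (step s a b c)
    obtain d where d: "d \<notin> {a, b, c}" using out[of "[a, b, c]"] by auto
    obtain e where e: "e \<notin> {a, b, c, d}" using out[of "[a, b, c, d]"] by auto
    have "perm (cyc3 a b c) \<in> D"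
    proof (rule com)
      show "perm (cyc3 a b d) \<otimes>\<^bsub>?G\<^esub> perm (cyc3 b e c) =
        perm (cyc3 a b c) \<otimes>\<^bsub>?G\<^esub> (perm (cyc3 b e c) \<otimes>\<^bsub>?G\<^esub> perm (cyc3 a b d))"
        using cyc3_commutator[of a b c d e] step(2) d e by (auto simp: comp_assoc)
    qed (use step(2) d e in \<open>auto intro!: perm_in_carrier cyc3_in_group\<close>)
    from subgroup.m_closed[OF D this step.IH] show ?case by (simp add: comp_def)
  qed
  have ratio: "diag (ratio i j v) \<in> D" if ij: "i \<noteq> j" and v9: "v ^ 9 = 1" for i j :: 'i and v
  proof -
    obtain k where k: "k \<notin> {i, j}" using out[of "[i, j]"] by auto
    obtain l where l: "l \<notin> {i, j, k}" using out[of "[i, j, k]"] by auto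
    have v: "v * v ^ 8 = 1" using v9 by (simp flip: power_Suc)
    have "diag (ratio i k v) \<in> D" if ik: "i \<noteq> k" and j: "j \<notin> {i, k}" and l: "l \<notin> {i, j, k}" for i j k l
    proof (rule com)
      let ?s = "cyc3 i k l"
      \<comment> \<open>The cycle moves the entry \<open>v\<close> from position \<open>k\<close> to
        \<open>i\<close>, while the entry at \<open>j\<close> stays and cancels in the
        commutator.\<close>
      have "ratio k j v (?s m) = ratio i k v m * ratio k j v m" for m
      proof -
        have "m = i \<or> m = k \<or> m = j \<or> m = l \<or> m \<notin> {i, j, k, l}" by blast
        then show ?thesis
          using ik j l v by (elim disjE) (auto simp: ratio_def cyc3_def mult.commute[of _ v])
      qed
      then show "perm ?s \<otimes>\<^bsub>?G\<^esub> diag (ratio k j v) =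
          diag (ratio i k v) \<otimes>\<^bsub>?G\<^esub> (diag (ratio k j v) \<otimes>\<^bsub>?G\<^esub> perm ?s)"
        by simp
    qed (use ik j l v9 in \<open>auto intro!: perm_in_carrier cyc3_in_group ratio_in_carrier\<close>)
    from this[of i j k l] k l ij show ?thesis by auto
  qed
  have spike: "vec (spike i b) \<in> D" for i :: 'i and b
  proof -
    obtain j where j: "j \<notin> {i}" using out[of "[i]"] by auto
    show ?thesis
    proof (rule com)
      \<comment> \<open>The commutator multiplies coordinate \<open>i\<close> by
        \<open>7 - 1 = 6\<close>, and 16 is the inverse of 6 modulo 19.\<close>
      have "7 * (16 * b) = 112 * b" by (simp flip: mult.assoc)
      also have "(112::19) = 17" by simp
      also have "17 * b = b + 16 * b" by (simp add: algebra_simps)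
      finally have "ratio i j 4 m ^ 3 * spike i (16 * b) m = spike i b m + spike i (16 * b) m" for m
        by (simp add: ratio_4_cubed spike_def)
      then show "diag (ratio i j 4) \<otimes>\<^bsub>?G\<^esub> vec (spike i (16 * b)) =
          vec (spike i b) \<otimes>\<^bsub>?G\<^esub> (vec (spike i (16 * b)) \<otimes>\<^bsub>?G\<^esub> diag (ratio i j 4))"
        by simp
    qed (use j in \<open>auto intro!: vec_in_carrier ratio_in_carrier\<close>)
  qed
  have "g \<in> D" if g: "g \<in> carrier ?G" for g
  proof -
    obtain x u s where xus: "g = (x, u, s)" by (cases g)
    have u: "\<And>i. u i ^ 9 = 1" "(\<Prod>i\<in>UNIV. u i) = 1" and s: "s \<in> cyc3_group"
      using g by (auto simp: xus chiral_carrier)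
    have "diag u \<in> D" using D u ratio by (intro diag_from_ratios[of D u]) auto
    then show ?thesis
      unfolding xus using vec_from_spikes[OF D spike] perm[OF s]
      by (subst chiral_decompose) (intro subgroup.m_closed[OF D])
  qed
  moreover have "D \<subseteq> carrier ?G" using subgroup.subset[OF D] .
  ultimately have "D = carrier ?G" by blast
  then show ?thesis by (simp add: perfect_group_def group_axioms D_def)
qed

section \<open>Normal subgroups and central indecomposability\<close>

text \<open>Commutators with two matrices isolate one nonzero coordinate of \<open>x\<close>; its
  multiples, their conjugates under 3-cycles, and sums of these exhaust
  \<open>F\<^sup>n\<close>.\<close>

lemma normal_vec_full:
  assumes n: "9 dvd CARD('i::finite)" and M: "M \<lhd> chiral_group"
    and x: "vec (x :: 'i \<Rightarrow> 19) \<in> M" "x \<noteq> (\<lambda>_. 0)"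
  shows "vec y \<in> M"
proof -
  let ?G = "chiral_group :: 'i chiral monoid"
  interpret group ?G by (rule group_chiral)
  have sM: "subgroup M ?G" using M by (rule normal_imp_subgroup)
  note out = ex_not_in_short_list[OF n]
  obtain i where i: "x i \<noteq> 0" using x(2) by auto
  obtain j where j: "j \<notin> {i}" using out[of "[i]"] by auto
  obtain k where k: "k \<notin> {i, j}" using out[of "[i, j]"] by auto
  have scale: "vec (\<lambda>k. (u k ^ 3 - 1) * z k) \<in> M"
    if "vec z \<in> M" "diag u \<in> carrier ?G" for u z
    by (rule commutator_in_normal[OF M that(2,1) vec_in_carrier]) (simp add: algebra_simps)
  \<comment> \<open>Commutation with \<open>ratio i j 4\<close> kills the coordinates other than
    \<open>i\<close> and \<open>j\<close>, and commutation with \<open>ratio i k 4\<close> kills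
    \<open>j\<close>. Each multiplies coordinate \<open>i\<close> by 6, whence the factor
    36.\<close>
  define a where "a = 36 * x i"
  have a: "a \<noteq> 0" using i by (simp add: a_def Z19_mult_eq_0)
  have "vec (\<lambda>m. (ratio i k 4 m ^ 3 - 1) * ((ratio i j 4 m ^ 3 - 1) * x m)) \<in> M"
    using x j k by (intro scale ratio_in_carrier) auto
  also have "(\<lambda>m. (ratio i k 4 m ^ 3 - 1) * ((ratio i j 4 m ^ 3 - 1) * x m)) = spike i a"
  proof
    fix m
    have "m = i \<or> m = j \<or> m \<noteq> i \<and> m \<noteq> j" by blast
    then show "(ratio i k 4 m ^ 3 - 1) * ((ratio i j 4 m ^ 3 - 1) * x m) = spike i a m"
      using j k ratio_4_cubed(3)[of j i k] by (elim disjE) (auto simp: ratio_4_cubed spike_def a_def simp flip: mult.assoc)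
  qed
  finally have sp: "vec (spike i a) \<in> M" .
  have "vec (spike i (of_nat m * a)) \<in> M" for m
  proof (induction m)
    case 0
    have "spike i (of_nat 0 * a) = (\<lambda>_. 0)" by (auto simp: spike_def)
    then show ?case using subgroup.one_closed[OF sM] by (simp add: id_def)
  next
    case (Suc m)
    have "spike i (of_nat (Suc m) * a) = (\<lambda>k. spike i a k + spike i (of_nat m * a) k)"
      by (intro ext) (simp add: spike_def algebra_simps)
    then show ?case using vec_add_closed[OF sM sp Suc.IH] by (simp only:)
  qed
  then have all: "vec (spike i b) \<in> M" for b using Z19_multiple[OF a, of b] by auto
  have "vec (spike l b) \<in> M" for l b
  proof (cases "l = i")
    case False
    obtain m where m: "m \<notin> {i, l}" using out[of "[i, l]"] by auto
    \<comment> \<open>Conjugation by a 3-cycle through \<open>l\<close> and \<open>i\<close>,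
      completed by a spare index \<open>m\<close>, carries coordinate \<open>i\<close> to
      \<open>l\<close>.\<close>
    have "spike i b (cyc3 l i m r) = spike l b r" for r
      using False m by (auto simp: spike_def cyc3_def)
    then have "perm (cyc3 l i m) \<otimes>\<^bsub>?G\<^esub> vec (spike i b) = vec (spike l b) \<otimes>\<^bsub>?G\<^esub> perm (cyc3 l i m)"
      by simp
    moreover have "perm (cyc3 l i m) \<in> carrier ?G" using False m by (intro perm_in_carrier cyc3_in_group) auto
    ultimately show ?thesis using conjugate_in_normal[OF M _ all vec_in_carrier] by blast
  qed (use all in simp)
  then show ?thesis using vec_from_spikes[OF sM] by blast
qed

text \<open>Testing on the unit vector at \<open>s i\<close> gives a nonzero value
  \<open>u i ^ 3\<close> on the left, while the right side vanishes unless
  \<open>s i = i\<close>.\<close>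

lemma scalar_on_vec:
  fixes x u :: "'i::finite \<Rightarrow> 19"
  assumes g: "(x, u, s) \<in> carrier chiral_group"
    and sc: "\<And>y. (x, u, s) \<otimes>\<^bsub>chiral_group\<^esub> vec y = vec (\<lambda>i. c * y i) \<otimes>\<^bsub>chiral_group\<^esub> (x, u, s)"
  shows "s = id" "u i ^ 3 = c"
proof -
  have *: "u i ^ 3 * y (s i) = c * y i" for y i
    using sc[of y] by (simp add: fun_eq_iff add.commute)
  have "s i = i \<and> u i ^ 3 = c" for i
  proof -
    have "u i ^ 3 * (u i ^ 3) ^ 2 = u i ^ 9" by (simp flip: power_Suc power_mult)
    moreover have "u i ^ 9 = 1" using g by (simp add: chiral_carrier)
    ultimately have u: "u i ^ 3 \<noteq> 0" by (metis mult_zero_left zero_neq_one)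
    have eq: "u i ^ 3 = c * spike (s i) 1 i" using *[of i "spike (s i) 1"] by (simp add: spike_def)
    then have "spike (s i) 1 i \<noteq> 0" using u by (metis mult_zero_right)
    then have "s i = i" by (simp add: spike_def split: if_splits)
    then show ?thesis using eq by (simp add: spike_def)
  qed
  then show "s = id" "u i ^ 3 = c" by (auto simp: fun_eq_iff)
qed

lemma vec_normalized:
  "(x, u, s) \<otimes>\<^bsub>chiral_group\<^esub> vec y = vec (\<lambda>i. u i ^ 3 * y (s i)) \<otimes>\<^bsub>chiral_group\<^esub> (x, u, s)"
  by (simp add: add.commute)

text \<open>The commutator of \<open>vec y\<close> with an element of \<open>M\<close> is again a
  vector and lies in \<open>M\<close>, so it is trivial.\<close>

lemma normal_trivial_action:
  fixes x u :: "'i::finite \<Rightarrow> 19"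
  assumes M: "M \<lhd> chiral_group" and g: "(x, u, s) \<in> M"
    and z: "\<And>y. vec y \<in> M \<Longrightarrow> y = (\<lambda>_. 0)"
  shows "u i ^ 3 * y (s i) = y i"
proof -
  let ?w = "\<lambda>i. y i - u i ^ 3 * y (s i)"
  have "vec y \<otimes>\<^bsub>chiral_group\<^esub> (x, u, s) =
      vec ?w \<otimes>\<^bsub>chiral_group\<^esub> ((x, u, s) \<otimes>\<^bsub>chiral_group\<^esub> vec y)"
    by simp
  then have "vec ?w \<in> M"
    by (rule group.commutator_in_normal[OF group_chiral M vec_in_carrier g vec_in_carrier])
  from fun_cong[OF z[OF this], of i] show ?thesis by simp
qed

text \<open>A factor containing a nonzero vector is everything. Two proper factors therefore meet
  \<open>F\<^sup>n\<close> trivially, hence act trivially on it, and so would their product, the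
  whole group.\<close>

lemma centrally_indecomposable_chiral:
  assumes n: "9 dvd CARD('i::finite)"
  shows "centrally_indecomposable (chiral_group :: 'i chiral monoid)"
proof -
  let ?G = "chiral_group :: 'i chiral monoid"
  interpret group ?G by (rule group_chiral)
  obtain i j :: 'i where ij: "j \<notin> set [i]" using ex_not_in_short_list[OF n, of "[_]"] by fastforce
  let ?y = "spike i 1"
  have nontriv: "\<not> trivial_group ?G"
  proof
    assume "trivial_group ?G"
    then have "vec ?y = \<one>\<^bsub>?G\<^esub>" using vec_in_carrier[of ?y] by (auto simp: trivial_group_def)
    then have "?y i = 0" by simp
    then show False by (simp add: spike_def)
  qed
  \<comment> \<open>\<open>H\<close> contains all of \<open>F\<^sup>n\<close>, so \<open>K\<close>
    centralizes it and consists of elements \<open>(x, u, id)\<close> with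
    \<open>u i ^ 3 = 1\<close>. Such elements commute with one another.\<close>
  have full: "H = carrier ?G" if cp: "central_product ?G H K" and x: "vec x \<in> H" "x \<noteq> (\<lambda>_. 0)" for H K x
  proof (rule central_product_comm_factor[OF cp perfect_chiral[OF n]])
    have vH: "vec y \<in> H" for y
      by (rule normal_vec_full[OF n central_product_normal[OF cp] x])
    have form: "\<exists>x u. k = (x, u, id) \<and> (\<forall>i. u i ^ 3 = 1)" if k: "k \<in> K" for k
    proof -
      obtain x u s where xus: "k = (x, u, s)" by (cases k)
      have kc: "k \<in> carrier ?G" using k cp by (auto simp: central_product_def dest: subgroup.mem_carrier)
      have "(x, u, s) \<otimes>\<^bsub>?G\<^esub> vec y = vec (\<lambda>i. 1 * y i) \<otimes>\<^bsub>?G\<^esub> (x, u, s)" for y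
        using central_product_commute[OF cp vH k, of y] by (simp only: xus mult_1_left)
      from scalar_on_vec[OF kc[unfolded xus] this] show ?thesis using xus by blast
    qed
    show "k \<otimes>\<^bsub>?G\<^esub> l = l \<otimes>\<^bsub>?G\<^esub> k" if "k \<in> K" "l \<in> K" for k l
      using form[OF that(1)] form[OF that(2)] by (auto simp: add.commute mult.commute)
  qed
  have "H = carrier ?G \<or> K = carrier ?G" if cp: "central_product ?G H K" for H K
  proof -
    have act: "u i ^ 3 * z (s i) = z i"
      if cp: "central_product ?G A B" and g: "(x, u, s) \<in> A" and A: "A \<noteq> carrier ?G" for A B x u s z i
      using normal_trivial_action[OF central_product_normal[OF cp] g] full[OF cp] A by blast
    show ?thesis
    proof (rule ccontr)
      assume "\<not> ?thesis"
      then have ne: "H \<noteq> carrier ?G" "K \<noteq> carrier ?G" by auto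
      \<comment> \<open>An element acting nontrivially: it multiplies coordinate \<open>i\<close> by
        7.\<close>
      have "diag (ratio i j 4) \<in> carrier ?G" using ij by (intro ratio_in_carrier) auto
      then obtain g h where gh: "g \<in> H" "h \<in> K" "diag (ratio i j 4) = g \<otimes>\<^bsub>?G\<^esub> h"
        using cp unfolding central_product_def set_mult_def by blast
      obtain x u s where g: "g = (x, u, s)" by (cases g)
      obtain x' v t where h: "h = (x', v, t)" by (cases h)
      have "ratio i j 4 = (\<lambda>i. u i * v (s i))" "t \<circ> s = id" using gh(3) by (simp_all add: g h)
      then have "ratio i j 4 i ^ 3 * ?y i = u i ^ 3 * (v (s i) ^ 3 * ?y (t (s i)))"
        by (simp add: power_mult_distrib fun_eq_iff)
      also have "v (s i) ^ 3 * ?y (t (s i)) = ?y (s i)"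
        using act[OF central_product_sym[OF cp] gh(2)[unfolded h] ne(2), of "s i" ?y] .
      also have "u i ^ 3 * ?y (s i) = ?y i"
        using act[OF cp gh(1)[unfolded g] ne(1), of i ?y] .
      finally show False by (simp add: ratio_4_cubed spike_def)
    qed
  qed
  then show ?thesis
    unfolding centrally_indecomposable_def using perfect_chiral[OF n] nontriv by blast
qed

section \<open>The central scalar 7 under automorphisms\<close>

text \<open>Diagonal matrices act on vectors through their cubes, and \<open>7 ^ 3 = 1\<close>, so
  translations commute with this scalar too.\<close>

lemma diag_7_central:
  "diag (\<lambda>_. 7) \<otimes>\<^bsub>chiral_group\<^esub> (x, u, s) = (x, u, s) \<otimes>\<^bsub>chiral_group\<^esub> diag (\<lambda>_. 7)"
proof -
  have "(7::19) ^ 3 = 1" by simp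
  then have *: "7 ^ 3 * x i = x i" for i by (simp only: mult_1_left)
  show ?thesis unfolding chiral_mult id_apply * by (simp add: mult.commute comp_def)
qed

lemma scalar_cube_pow:
  assumes "\<And>i. u i ^ 3 = c"
  shows "(x, u, id) [^]\<^bsub>chiral_group\<^esub> m = ((\<lambda>i. (\<Sum>k<m. c ^ k) * x i), \<lambda>i. u i ^ m, id)"
proof (induction m)
  case (Suc m)
  have "(u i ^ m) ^ 3 = c ^ m" for i unfolding assms[of i, symmetric] by (simp flip: power_mult add: mult.commute)
  with Suc show ?case by (simp add: algebra_simps comp_def)
qed (simp add: id_def)

text \<open>The image of \<open>F\<^sup>n\<close> is normal. If it contains a nonzero vector, it
  contains \<open>F\<^sup>n\<close> and equals it by cardinality. Otherwise its elements act
  trivially on \<open>F\<^sup>n\<close>, and the exponent 19 of \<open>F\<^sup>n\<close> leads to a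
  contradiction.\<close>

lemma iso_vec_image:
  fixes \<phi> :: "('i::finite) chiral \<Rightarrow> 'i chiral"
  assumes n: "9 dvd CARD('i)"
    and \<phi>: "\<phi> \<in> iso chiral_group chiral_group"
  shows "\<phi> ` range vec = range vec"
proof -
  let ?G = "chiral_group :: 'i chiral monoid"
  let ?N = "range vec :: 'i chiral set"
  interpret group ?G by (rule group_chiral)
  interpret h: group_hom ?G ?G \<phi>
    using \<phi> by (simp add: group_hom_def group_hom_axioms_def iso_def group_axioms)
  have bij: "bij_betw \<phi> (carrier ?G) (carrier ?G)" using \<phi> by (simp add: iso_def)
  have Nc: "?N \<subseteq> carrier ?G" using vec_in_carrier by auto
  have nN: "?N \<lhd> ?G"
  proof (rule normal_invI)
    show "subgroup ?N ?G"
    proof (rule subgroupI[OF Nc])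
      show "inv\<^bsub>?G\<^esub> a \<in> ?N" if "a \<in> ?N" for a
      proof -
        from that obtain y where a: "a = vec y" by auto
        have "vec (\<lambda>i. - y i) \<otimes>\<^bsub>?G\<^esub> vec y = \<one>\<^bsub>?G\<^esub>" by simp
        then have "inv\<^bsub>?G\<^esub> (vec y) = vec (\<lambda>i. - y i)" by (rule inv_equality) (rule vec_in_carrier)+
        then show ?thesis using a by auto
      qed
    qed auto
    fix g a assume g: "g \<in> carrier ?G" and a: "a \<in> ?N"
    obtain x u s where xus: "g = (x, u, s)" by (cases g)
    obtain y where y: "a = vec y" using a by auto
    have "g \<otimes>\<^bsub>?G\<^esub> a = vec (\<lambda>i. u i ^ 3 * y (s i)) \<otimes>\<^bsub>?G\<^esub> g"
      unfolding xus y by (rule vec_normalized)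
    moreover have "a \<in> carrier ?G" using a Nc by blast
    ultimately have "g \<otimes>\<^bsub>?G\<^esub> a \<otimes>\<^bsub>?G\<^esub> inv\<^bsub>?G\<^esub> g = vec (\<lambda>i. u i ^ 3 * y (s i))"
      using inv_solve_right'[OF vec_in_carrier _ g] g by blast
    then show "g \<otimes>\<^bsub>?G\<^esub> a \<otimes>\<^bsub>?G\<^esub> inv\<^bsub>?G\<^esub> g \<in> ?N" by auto
  qed
  let ?M = "\<phi> ` ?N"
  have nM: "?M \<lhd> ?G" by (rule iso_normal_subgroup[OF \<phi> group_axioms group_axioms nN])
  have "\<exists>x. vec x \<in> ?M \<and> x \<noteq> (\<lambda>_. 0)"
  proof (rule ccontr)
    assume "\<not> ?thesis"
    then have z: "x = (\<lambda>_. 0)" if "vec x \<in> ?M" for x using that by blast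
    \<comment> \<open>Any nonzero vector would do; \<open>undefined\<close> serves as an arbitrary
      index.\<close>
    let ?e = "vec (spike undefined 1) :: 'i chiral"
    obtain x u s where e: "\<phi> ?e = (x, u, s)" by (cases "\<phi> ?e")
    have eM: "(x, u, s) \<in> ?M" unfolding e[symmetric] by (intro imageI rangeI)
    have ec: "(x, u, s) \<in> carrier ?G" unfolding e[symmetric] by (intro h.hom_closed vec_in_carrier)
    have act: "u i ^ 3 * y (s i) = y i" for y i by (rule normal_trivial_action[OF nM eM z])
    have u3: "u i ^ 3 = 1" for i using act[of i "\<lambda>_. 1"] by simp
    have "(x, u, s) \<otimes>\<^bsub>?G\<^esub> vec y = vec (\<lambda>i. 1 * y i) \<otimes>\<^bsub>?G\<^esub> (x, u, s)" for y
      by (simp add: act add.commute)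
    then have s: "s = id" by (rule scalar_on_vec[OF ec])
    have z19: "(\<Sum>k<19. 1 ^ k) = (0::19)" by simp
    have "?e [^]\<^bsub>?G\<^esub> (19::nat) = \<one>\<^bsub>?G\<^esub>"
      unfolding scalar_cube_pow[of "\<lambda>_. 1" 1, OF power_one]
      by (simp only: z19 mult_zero_left power_one chiral_one)
    then have "(x, u, s) [^]\<^bsub>?G\<^esub> (19::nat) = \<one>\<^bsub>?G\<^esub>"
      using h.hom_nat_pow[OF vec_in_carrier, of "spike undefined 1" 19] by (simp only: e h.hom_one)
    then have "(\<lambda>i. u i ^ 19) = (\<lambda>_. 1)"
      unfolding s by (subst (asm) scalar_cube_pow[where c = 1]) (simp_all add: u3)
    \<comment> \<open>As 19 is 1 modulo 3, an entry whose 3rd and 19th powers are 1 is itself 1. So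
      \<open>\<phi> ?e\<close> is a vector in the image, hence trivial.\<close>
    moreover have "u i ^ 19 = (u i ^ 3) ^ 6 * u i" for i
    proof -
      have "u i ^ 19 = u i ^ Suc (3 * 6)" by (rule arg_cong) simp
      then show ?thesis by (simp only: power_Suc2 power_mult)
    qed
    ultimately have "u = (\<lambda>_. 1)" by (simp add: u3 fun_eq_iff)
    then have "\<phi> ?e = vec x" using e s by simp
    moreover have "x = (\<lambda>_. 0)" using eM \<open>u = _\<close> s by (intro z) simp
    ultimately have "\<phi> ?e = \<phi> \<one>\<^bsub>?G\<^esub>" by (simp only: h.hom_one) (simp only: chiral_one)
    then have "?e = \<one>\<^bsub>?G\<^esub>" by (rule inj_onD[OF bij_betw_imp_inj_on[OF bij] _ vec_in_carrier one_closed])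
    then have "spike undefined 1 (undefined :: 'i) = 0" by (metis chiral_one prod.inject)
    then show False by (simp add: spike_def)
  qed
  then have "?N \<subseteq> ?M" using normal_vec_full[OF n nM] by blast
  moreover have "card ?M \<le> card ?N" by (rule card_image_le) simp
  ultimately show ?thesis using card_seteq[of ?M ?N] by simp
qed

lemma iso_fixes_diag_7:
  fixes \<phi> :: "('i::finite) chiral \<Rightarrow> 'i chiral"
  assumes n: "9 dvd CARD('i)"
    and \<phi>: "\<phi> \<in> iso chiral_group chiral_group"
  shows "\<phi> (diag (\<lambda>_. 7)) = diag (\<lambda>_. 7)"
proof -
  let ?G = "chiral_group :: 'i chiral monoid"
  interpret group ?G by (rule group_chiral)
  interpret h: group_hom ?G ?G \<phi>
    using \<phi> by (simp add: group_hom_def group_hom_axioms_def iso_def group_axioms)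
  let ?c = "diag (\<lambda>_. 4) :: 'i chiral"
  have c: "?c \<in> carrier ?G" using n by (intro diag_const_in_carrier) simp_all
  obtain x u s where g: "\<phi> ?c = (x, u, s)" by (cases "\<phi> ?c")
  have gc: "(x, u, s) \<in> carrier ?G" unfolding g[symmetric] by (intro h.hom_closed c)
  have four: "(4::19) ^ 3 = 7" by simp
  \<comment> \<open>Writing \<open>7 * y\<close> as a seventh power makes "acts on
    \<open>F\<^sup>n\<close> as the scalar 7" a statement about the group product, which
    \<open>\<phi>\<close> preserves because it maps \<open>F\<^sup>n\<close> onto itself.\<close>
  have pow7: "vec (\<lambda>i. 7 * y i) = vec y [^]\<^bsub>?G\<^esub> (7::nat)" for y
    by (subst scalar_cube_pow[where c = 1]) simp_all
  have sc: "(x, u, s) \<otimes>\<^bsub>?G\<^esub> vec y = vec (\<lambda>i. 7 * y i) \<otimes>\<^bsub>?G\<^esub> (x, u, s)" for y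
  proof -
    have "vec y \<in> \<phi> ` range vec" unfolding iso_vec_image[OF n \<phi>] by simp
    then obtain y' where y': "\<phi> (vec y') = vec y" by auto
    have "?c \<otimes>\<^bsub>?G\<^esub> vec y' = vec y' [^]\<^bsub>?G\<^esub> (7::nat) \<otimes>\<^bsub>?G\<^esub> ?c"
      unfolding pow7[symmetric] chiral_mult four by simp
    then have "\<phi> (?c \<otimes>\<^bsub>?G\<^esub> vec y') = \<phi> (vec y' [^]\<^bsub>?G\<^esub> (7::nat) \<otimes>\<^bsub>?G\<^esub> ?c)" by (rule arg_cong)
    then show ?thesis
      unfolding pow7 by (simp only: h.hom_mult h.hom_nat_pow vec_in_carrier c nat_pow_closed g y')
  qed
  have s: "s = id" and u: "\<And>i. u i ^ 3 = 7" using scalar_on_vec[OF gc sc] by auto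
  have "diag (\<lambda>_. 7) = ?c [^]\<^bsub>?G\<^esub> (3::nat)"
    unfolding scalar_cube_pow[OF four] four by simp
  then have "\<phi> (diag (\<lambda>_. 7)) = (x, u, id) [^]\<^bsub>?G\<^esub> (3::nat)"
    by (simp only: h.hom_nat_pow c g s)
  also have "\<dots> = ((\<lambda>i. (\<Sum>k<3. 7 ^ k) * x i), \<lambda>i. 7, id)"
    by (subst scalar_cube_pow[OF u]) (simp add: u)
  also have "(\<Sum>k<3. 7 ^ k) = (0::19)" by (simp add: eval_nat_numeral)
  finally show ?thesis by (simp only: mult_zero_left)
qed

section \<open>Assembly of the example\<close>

lemma chiral_group_properties:
  defines "a \<equiv> diag (\<lambda>_. 7) :: ('i::finite) chiral"
  assumes n: "9 dvd CARD('i)"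
  shows "a \<in> carrier chiral_group" "a [^]\<^bsub>chiral_group\<^esub> (3::nat) = \<one>\<^bsub>chiral_group\<^esub>"
    "a \<noteq> \<one>\<^bsub>chiral_group\<^esub>" "aut_fixed chiral_group a"
    "x \<in> carrier chiral_group \<Longrightarrow> a \<otimes>\<^bsub>chiral_group\<^esub> x = x \<otimes>\<^bsub>chiral_group\<^esub> a"
proof -
  show "a \<in> carrier chiral_group" unfolding a_def using n by (intro diag_const_in_carrier) simp_all
  have "(7::19) ^ 3 = 1" by simp
  then show "a [^]\<^bsub>chiral_group\<^esub> (3::nat) = \<one>\<^bsub>chiral_group\<^esub>"
    unfolding a_def by (simp only: scalar_cube_pow mult_zero_right chiral_one)
  show "a \<noteq> \<one>\<^bsub>chiral_group\<^esub>" by (simp add: a_def fun_eq_iff)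
  show "aut_fixed chiral_group a" unfolding aut_fixed_def a_def using iso_fixes_diag_7[OF n] by blast
  show "a \<otimes>\<^bsub>chiral_group\<^esub> x = x \<otimes>\<^bsub>chiral_group\<^esub> a"
    unfolding a_def by (cases x) (simp only: diag_7_central)
qed

text \<open>Crude bounds suffice: all triples for dimension 9 number
  \<open>19 ^ 9 * 19 ^ 9 * 9 ^ 9\<close>, fewer than the \<open>19 ^ 27\<close> vectors alone for
  dimension 27.\<close>

lemma card_chiral_less:
  "card (carrier (chiral_group :: 9 chiral monoid)) < card (carrier (chiral_group :: 27 chiral monoid))"
proof -
  have "card (carrier (chiral_group :: 9 chiral monoid)) \<le> CARD(9 chiral)"
    by (intro card_mono) simp_all
  also have "\<dots> < 19 ^ 27" by (simp add: card_fun)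
  also have "\<dots> = card (range (vec :: (27 \<Rightarrow> 19) \<Rightarrow> _))"
    by (subst card_image) (simp_all add: inj_on_def card_fun)
  also have "\<dots> \<le> card (carrier (chiral_group :: 27 chiral monoid))"
    by (intro card_mono) (auto simp: vec_in_carrier)
  finally show ?thesis .
qed

theorem proposition7p10:
  shows "\<exists>(G :: nat monoid) Q1 Q2.
    central_product G Q1 Q2 \<and>
    finite Q1 \<and> perfect_group (G\<lparr>carrier := Q1\<rparr>) \<and> centrally_indecomposable (G\<lparr>carrier := Q1\<rparr>) \<and>
    finite Q2 \<and> perfect_group (G\<lparr>carrier := Q2\<rparr>) \<and> centrally_indecomposable (G\<lparr>carrier := Q2\<rparr>) \<and>
    characteristic_subgroup Q1 G \<and> characteristic_subgroup Q2 G \<and>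
    \<not> replace_opposite G Q1 Q2 \<cong> G \<and>
    characteristic_subgroup Q1 (replace_opposite G Q1 Q2) \<and>
    characteristic_subgroup Q2 (replace_opposite G Q1 Q2)"
proof -
  \<comment> \<open>Two multiples of 9, far enough apart for the crude comparison of orders.\<close>
  have n: "9 dvd CARD(9)" "9 dvd CARD(27)" by simp_all
  note A = chiral_group_properties[OF n(1)] and B = chiral_group_properties[OF n(2)]
  show ?thesis
    using card_chiral_less
    by (intro central_amalgam_replace_opposite[OF finite centrally_indecomposable_chiral[OF n(1)] A
          finite centrally_indecomposable_chiral[OF n(2)] B]) simp_all
qed

end
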